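(* Let \[ \mathfrak L_{\mathrm{lft}}=\{(K,\gamma,P)\in\mathbb R^{n_u\times n_x}\times\mathbb R_{++}\times\mathbb S_{++}^{n_x}:\mathscr M_{\mathrm{lft}}(K,\gamma,P)\preceq0\}, \] \[ \mathfrak F_{\mathrm{cvx}}=\{(\gamma,Y,X)\in\mathbb R_{++}\times\mathbb R^{n_u\times n_x}\times\mathbb S_{++}^{n_x}:\mathscr M_{\mathrm{cvx}}(\gamma,Y,X)\succeq0\}, \] and $\Phi(K,\gamma,P)=(\gamma,\gamma KP^{-1},\gamma P^{-1})$ for $(K,\gamma,P)\in\mathfrak L_{\mathrm{lft}}$, where $\mathscr M_{\mathrm{lft}},\mathscr M_{\mathrm{cvx}}$ are the matrices given in the context. Then: 1. For any $K\in\mathbb R^{n_u\times n_x}$ and $\gamma>0$, we have $(K,\gamma)\in\operatorname{epi}(J_\infty)$ if and only if there exists $P\in\mathbb S_{++}^{n_x}$ such that $(K,\gamma,P)\in\mathfrak L_{\mathrm{lft}}$. 2. $\Phi$ is a bijection from $\mathfrak L_{\mathrm{lft}}$ to $\mathfrak F_{\mathrm{cvx}}$, and both $\Phi$ and $\Phi^{-1}$ are infinitely differentiable.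
   Context: $\mathbb R_{++}$: positive reals; $\mathbb S_{++}^{n}$: real symmetric positive definite $n\times n$ matrices; $\preceq,\succeq$: Loewner order. $\mathcal H_\infty$ setting. $A\in\mathbb R^{n_x\times n_x}$, $B\in\mathbb R^{n_x\times n_u}$, $B_w\in\mathbb R^{n_x\times n_w}$; $(A,B)$ is controllable; $Q\in\mathbb R^{n_x\times n_x}$, $R\in\mathbb R^{n_u\times n_u}$ and $W:=B_wB_w^{\mathsf T}$ are symmetric positive definite. $\mathcal K=\{K\in\mathbb R^{n_u\times n_x}: A+BK\text{ is Schur stable}\}$ (all eigenvalues of modulus $<1$). For $K\in\mathcal K$, \[ J_\infty(K)=\Big[\sup_{w:\|w\|_{\ell_2}\le1}\sum_{t=0}^\infty x(t)^{\mathsf T}(Q+K^{\mathsf T}RK)x(t)\Big]^{1/2},\quad x(t+1)=(A+BK)x(t)+B_ww(t),\ x(0)=0, \] where $\|w\|_{\ell_2}^2=\sum_{t\ge0}w(t)^{\mathsf T}w(t)$. $\operatorname{epi}(J_\infty)=\{(K,\gamma):K\in\mathcal K,\ \gamma\ge J_\infty(K)\}$. \[ \mathscr M_{\mathrm{lft}}(K,\gamma,P)=\begin{bmatrix} (A+BK)^{\mathsf T}P(A+BK)-P+Q+K^{\mathsf T}RK & (A+BK)^{\mathsf T}PB_w \\ B_w^{\mathsf T}P(A+BK) & B_w^{\mathsf T}PB_w-\gamma^2I \end{bmatrix}, \] \[ \mathscr M_{\mathrm{cvx}}(\gamma,Y,X)=\begin{bmatrix} X & 0 & (AX+BY)^{\mathsf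 T} & X & Y^{\mathsf T} \\ 0 & \gamma I & B_w^{\mathsf T} & 0 & 0 \\ AX+BY & B_w & X & 0 & 0 \\ X & 0 & 0 & \gamma Q^{-1} & 0 \\ Y & 0 & 0 & 0 & \gamma R^{-1} \end{bmatrix}. \] A map defined on a possibly non-open set is called infinitely differentiable if it is the restriction of an infinitely differentiable map defined on an open superset (in the ambient space $\mathbb R^{n_u\times n_x}\times\mathbb R\times\mathbb S^{n_x}$, respectively $\mathbb R\times\mathbb R^{n_u\times n_x}\times\mathbb S^{n_x}$, with $\mathbb S^{n_x}$ the symmetric matrices). *)

theory Defs
  imports "HOL-Analysis.Analysis"
begin

definition symmetric_mat :: "real^'n^'n \<Rightarrow> bool" where
  "symmetric_mat M \<longleftrightarrow> transpose M = M"

definition pos_def :: "real^'n^'n \<Rightarrow> bool" where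
  "pos_def M \<longleftrightarrow> symmetric_mat M \<and> (\<forall>v. v \<noteq> 0 \<longrightarrow> v \<bullet> (M *v v) > 0)"

definition pos_semidef :: "real^'n^'n \<Rightarrow> bool" where
  "pos_semidef M \<longleftrightarrow> symmetric_mat M \<and> (\<forall>v. v \<bullet> (M *v v) \<ge> 0)"

definition loewner_le :: "real^'n^'n \<Rightarrow> real^'n^'n \<Rightarrow> bool"  (infix \<open>\<preceq>\<^sub>L\<close> 50) where
  "M \<preceq>\<^sub>L N \<longleftrightarrow> pos_semidef (N - M)"

definition schur_stable :: "real^'n^'n \<Rightarrow> bool" where
  "schur_stable M \<longleftrightarrow>
     (\<forall>(c::complex) v. v \<noteq> 0 \<and> map_matrix complex_of_real M *v v = c *s v \<longrightarrow> cmod c < 1)"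

text \<open>Block matrices: \<open>M ||| N\<close> places \<open>N\<close> to the right of \<open>M\<close>, and \<open>M === N\<close> places \<open>N\<close>
  below \<open>M\<close>. Sizes add up as sums of index types.\<close>

definition hcat :: "'a^'m^'k \<Rightarrow> 'a^'n^'k \<Rightarrow> 'a^('m + 'n)^'k"  (infixr \<open>|||\<close> 62) where
  "M ||| N = (\<chi> i j. case j of Inl k \<Rightarrow> M $ i $ k | Inr l \<Rightarrow> N $ i $ l)"

definition vcat :: "'a^'k^'m \<Rightarrow> 'a^'k^'n \<Rightarrow> 'a^'k^('m + 'n)"  (infixr \<open>===\<close> 61) where
  "M === N = (\<chi> i. case i of Inl k \<Rightarrow> M $ k | Inr l \<Rightarrow> N $ l)"

primrec trajectory ::
  "real^'x^'x \<Rightarrow> real^'u^'x \<Rightarrow> real^'x \<Rightarrow> (nat \<Rightarrow> real^'u) \<Rightarrow> nat \<Rightarrow> real^'x" where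
  "trajectory F G x0 u 0 = x0"
| "trajectory F G x0 u (Suc t) = F *v trajectory F G x0 u t + G *v u t"

definition controllable :: "real^'x^'x \<Rightarrow> real^'u^'x \<Rightarrow> bool" where
  "controllable A B \<longleftrightarrow> (\<forall>x0 x1. \<exists>T u. trajectory A B x0 u T = x1)"

definition stabilizing :: "real^'x^'x \<Rightarrow> real^'u^'x \<Rightarrow> (real^'x^'u) set" where
  "stabilizing A B = {K. schur_stable (A + B ** K)}"

definition l2_unit_ball :: "(nat \<Rightarrow> real^'w) set" where
  "l2_unit_ball = {w. summable (\<lambda>t. w t \<bullet> w t) \<and> (\<Sum>t. w t \<bullet> w t) \<le> 1}"

text \<open>Meaningful only for stabilizing \<open>K\<close>. There the response to a square-summable disturbance
  is square-summable with a uniform gain, so the series converges and the supremum is over a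
  bounded set of reals.\<close>

definition J_inf ::
  "real^'x^'x \<Rightarrow> real^'u^'x \<Rightarrow> real^'w^'x \<Rightarrow> real^'x^'x \<Rightarrow> real^'u^'u \<Rightarrow> real^'x^'u \<Rightarrow> real" where
  "J_inf A B Bw Q R K =
     sqrt (SUP w \<in> l2_unit_ball.
       (\<Sum>t. trajectory (A + B ** K) Bw 0 w t \<bullet>
            ((Q + transpose K ** R ** K) *v trajectory (A + B ** K) Bw 0 w t)))"

definition epi_J_inf ::
  "real^'x^'x \<Rightarrow> real^'u^'x \<Rightarrow> real^'w^'x \<Rightarrow> real^'x^'x \<Rightarrow> real^'u^'u \<Rightarrow> ((real^'x^'u) \<times> real) set" where
  "epi_J_inf A B Bw Q R = {(K, \<gamma>). K \<in> stabilizing A B \<and> \<gamma> \<ge> J_inf A B Bw Q R K}"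

definition M_lft ::
  "real^'x^'x \<Rightarrow> real^'u^'x \<Rightarrow> real^'w^'x \<Rightarrow> real^'x^'x \<Rightarrow> real^'u^'u \<Rightarrow>
   real^'x^'u \<Rightarrow> real \<Rightarrow> real^'x^'x \<Rightarrow> real^('x + 'w)^('x + 'w)" where
  "M_lft A B Bw Q R K \<gamma> P =
     (transpose (A + B ** K) ** P ** (A + B ** K) - P + Q + transpose K ** R ** K
        ||| transpose (A + B ** K) ** P ** Bw)
     ===
     (transpose Bw ** P ** (A + B ** K)
        ||| transpose Bw ** P ** Bw - \<gamma>\<^sup>2 *\<^sub>R mat 1)"

definition M_cvx ::
  "real^'x^'x \<Rightarrow> real^'u^'x \<Rightarrow> real^'w^'x \<Rightarrow> real^'x^'x \<Rightarrow> real^'u^'u \<Rightarrow>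
   real \<Rightarrow> real^'x^'u \<Rightarrow> real^'x^'x \<Rightarrow>
   real^('x + 'w + 'x + 'x + 'u)^('x + 'w + 'x + 'x + 'u)" where
  "M_cvx A B Bw Q R \<gamma> Y X =
     (X               ||| 0               ||| transpose (A ** X + B ** Y) ||| X                     ||| transpose Y) ===
     (0               ||| \<gamma> *\<^sub>R mat 1    ||| transpose Bw                ||| 0                     ||| 0) ===
     (A ** X + B ** Y ||| Bw              ||| X                           ||| 0                     ||| 0) ===
     (X               ||| 0               ||| 0                           ||| \<gamma> *\<^sub>R matrix_inv Q ||| 0) ===
     (Y               ||| 0               ||| 0                           ||| 0                     ||| \<gamma> *\<^sub>R matrix_inv R)"

definition L_lft ::
  "real^'x^'x \<Rightarrow> real^'u^'x \<Rightarrow> real^'w^'x \<Rightarrow> real^'x^'x \<Rightarrow> real^'u^'u \<Rightarrow>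
   ((real^'x^'u) \<times> real \<times> (real^'x^'x)) set" where
  "L_lft A B Bw Q R = {(K, \<gamma>, P). \<gamma> > 0 \<and> pos_def P \<and> M_lft A B Bw Q R K \<gamma> P \<preceq>\<^sub>L 0}"

definition F_cvx ::
  "real^'x^'x \<Rightarrow> real^'u^'x \<Rightarrow> real^'w^'x \<Rightarrow> real^'x^'x \<Rightarrow> real^'u^'u \<Rightarrow>
   (real \<times> (real^'x^'u) \<times> (real^'x^'x)) set" where
  "F_cvx A B Bw Q R = {(\<gamma>, Y, X). \<gamma> > 0 \<and> pos_def X \<and> 0 \<preceq>\<^sub>L M_cvx A B Bw Q R \<gamma> Y X}"

definition \<Phi> :: "(real^'x^'u) \<times> real \<times> (real^'x^'x) \<Rightarrow> real \<times> (real^'x^'u) \<times> (real^'x^'x)" where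
  "\<Phi> = (\<lambda>(K, \<gamma>, P). (\<gamma>, \<gamma> *\<^sub>R (K ** matrix_inv P), \<gamma> *\<^sub>R matrix_inv P))"

text \<open>The ambient spaces contain the symmetric matrices as a factor, so they are linear subspaces
  \<open>E\<close> of the underlying types, and openness and derivatives are relative to \<open>E\<close>. For \<open>U\<close> open in
  \<open>E\<close> the derivative within \<open>U\<close> is unique as a map on \<open>E\<close>, and only its directional
  derivatives along \<open>v \<in> E\<close> enter the recursion. For finite-dimensional \<open>E\<close>,
  continuity of all of these up to order \<open>k\<close> is the usual class of \<open>k\<close> times continuously
  differentiable maps.\<close>

primrec Ck_on ::
  "nat \<Rightarrow> 'a::real_normed_vector set \<Rightarrow> 'a set \<Rightarrow> ('a \<Rightarrow> 'b::real_normed_vector) \<Rightarrow> bool" where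
  "Ck_on 0 E U f = continuous_on U f"
| "Ck_on (Suc k) E U f =
     (\<exists>f'. (\<forall>x\<in>U. (f has_derivative f' x) (at x within U)) \<and>
           (\<forall>v\<in>E. Ck_on k E U (\<lambda>x. f' x v)))"

text \<open>\<open>f\<close>, defined on the arbitrary subset \<open>D\<close> of \<open>E\<close> and with values in \<open>F\<close>, is the
  restriction of an infinitely differentiable map from an open subset of \<open>E\<close> into \<open>F\<close>.\<close>

definition inf_differentiable_on ::
  "'a::real_normed_vector set \<Rightarrow> 'b::real_normed_vector set \<Rightarrow> 'a set \<Rightarrow> ('a \<Rightarrow> 'b) \<Rightarrow> bool" where
  "inf_differentiable_on E F D f \<longleftrightarrow>
     (\<exists>U g. openin (top_of_set E) U \<and> D \<subseteq> U \<and> g ` U \<subseteq> F \<and>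
            (\<forall>k. Ck_on k E U g) \<and> (\<forall>x\<in>D. g x = f x))"

definition ambient_lft :: "((real^'x^'u) \<times> real \<times> (real^'x^'x)) set" where
  "ambient_lft = UNIV \<times> UNIV \<times> {P. symmetric_mat P}"

definition ambient_cvx :: "(real \<times> (real^'x^'u) \<times> (real^'x^'x)) set" where
  "ambient_cvx = UNIV \<times> UNIV \<times> {X. symmetric_mat X}"

end

theory Submission
  imports Defs "HOL-Computational_Algebra.Fundamental_Theorem_Algebra"
begin

text \<open>If the matrix inequality holds, then \<open>x\<^sup>T P x\<close> is a storage function: it decreases along
  undisturbed orbits, which gives Schur stability, and summing the dissipation inequality bounds the
  gain by \<open>\<gamma>\<close>. Conversely, the available storage \<open>V x\<close>, the supremum over finite horizons and
  disturbances of \<open>\<Sum> x\<^sup>T S x - \<gamma>\<^sup>2 |w|\<^sup>2\<close> from the initial state \<open>x\<close>, is finite because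
  \<open>B\<^sub>w\<close> is onto. As a supremum of a jointly quadratic function it satisfies the parallelogram law,
  hence is a quadratic form \<open>x\<^sup>T P x\<close>, and the Bellman inequality for \<open>V\<close> is the matrix inequality.
  This also covers the case where \<open>\<gamma>\<close> equals the norm, in which Riccati recursions can break
  down. The two matrix inequalities are related by completing squares in the last three block
  variables of the convex one.\<close>

subsection \<open>Smoothness of the matrix inverse\<close>

lemma matrix_inv_inverse:
  assumes "invertible M"
  shows "M ** matrix_inv M = mat 1 \<and> matrix_inv M ** M = mat 1"
  using assms unfolding invertible_def matrix_inv_def by (rule someI_ex)

lemmas matrix_inv_right = matrix_inv_inverse[THEN conjunct1]
lemmas matrix_inv_left = matrix_inv_inverse[THEN conjunct2]

lemma matrix_inv_unique:
  assumes "M ** N = mat 1" "N ** M = mat 1"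
  shows "matrix_inv M = N"
proof -
  have "invertible M" using assms invertible_def by blast
  then show ?thesis
    using matrix_inv_right[of M] assms by (metis matrix_mul_assoc matrix_mul_lid matrix_mul_rid)
qed

lemma invertible_matrix_inv: "invertible M \<Longrightarrow> invertible (matrix_inv M)"
  using matrix_inv_inverse invertible_def by blast

lemma matrix_inv_matrix_inv: "invertible M \<Longrightarrow> matrix_inv (matrix_inv M) = M"
  by (simp add: matrix_inv_unique matrix_inv_inverse)

lemma matrix_mul_scaleR_left: "(c *\<^sub>R M) ** N = c *\<^sub>R (M ** N)" for M :: "real^'n^'m"
  by (simp add: scalar_matrix_assoc)

lemma matrix_mul_scaleR_right: "M ** (c *\<^sub>R N) = c *\<^sub>R (M ** N)" for M :: "real^'n^'m"
  by (simp add: matrix_matrix_mult_def vec_eq_iff sum_distrib_left mult.left_commute)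

lemma matrix_inv_scaleR:
  fixes M :: "real^'n^'n"
  assumes "invertible M" "c \<noteq> 0"
  shows "matrix_inv (c *\<^sub>R M) = inverse c *\<^sub>R matrix_inv M"
  using assms by (intro matrix_inv_unique)
    (simp_all add: matrix_mul_scaleR_left matrix_mul_scaleR_right matrix_inv_right matrix_inv_left)

lemma symmetric_mat_matrix_inv:
  fixes M :: "real^'n^'n"
  assumes "invertible M" "symmetric_mat M"
  shows "symmetric_mat (matrix_inv M)"
proof -
  have "transpose (matrix_inv M ** M) = transpose M ** transpose (matrix_inv M)"
    "transpose (M ** matrix_inv M) = transpose (matrix_inv M) ** transpose M"
    by (simp_all only: matrix_transpose_mul)
  then have "M ** transpose (matrix_inv M) = mat 1" "transpose (matrix_inv M) ** M = mat 1"
    using assms by (metis matrix_inv_left symmetric_mat_def transpose_mat,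
        metis matrix_inv_right symmetric_mat_def transpose_mat)
  then show ?thesis using matrix_inv_unique unfolding symmetric_mat_def by metis
qed

lemma symmetric_mat_scaleR: "symmetric_mat M \<Longrightarrow> symmetric_mat (c *\<^sub>R M)"
  for M :: "real^'n^'n"
  by (simp add: symmetric_mat_def transpose_scalar)

lemma bounded_bilinear_matrix_mult: "bounded_bilinear ((**) :: real^'n^'m \<Rightarrow> real^'k^'n \<Rightarrow> _)"
  unfolding bilinear_conv_bounded_bilinear[symmetric] bilinear_def
  by (auto intro!: linearI simp: matrix_mul_scaleR_left matrix_mul_scaleR_right matrix_add_ldistrib)
    (simp add: matrix_matrix_mult_def vec_eq_iff distrib_right sum.distrib)

lemma continuous_on_det: "continuous_on S (det :: real^'n^'n \<Rightarrow> real)"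
  unfolding det_def by (intro continuous_intros)

lemma open_invertible: "open {M :: real^'n^'n. invertible M}"
proof -
  have "open (det -` (- {0 :: real}) :: (real^'n^'n) set)"
    by (intro open_vimage continuous_on_det) auto
  also have "det -` (- {0 :: real}) = {M :: real^'n^'n. invertible M}"
    by (auto simp: invertible_det_nz)
  finally show ?thesis .
qed

text \<open>Cramer's rule writes every entry of the inverse as a quotient of determinants, which are
  polynomials in matrix entries, and the denominator \<open>det M\<close> does not vanish on this
  set.\<close>

lemma continuous_on_matrix_inv: "continuous_on {M. invertible M} (matrix_inv :: real^'n^'n \<Rightarrow> _)"
proof -
  have entry: "matrix_inv M $ k $ l
      = det (\<chi> i j. if j = k then axis l 1 $ i else M $ i $ j) / det M"
    if "invertible M" for M :: "real^'n^'n" and k l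
  proof -
    have "M *v column l (matrix_inv M) = axis l 1"
      by (metis that matrix_vector_mult_basis matrix_vector_mul_assoc matrix_inv_right
          matrix_vector_mul_lid)
    then have "column l (matrix_inv M)
        = (\<chi> k. det (\<chi> i j. if j = k then axis l 1 $ i else M $ i $ j) / det M)"
      using that by (subst (asm) cramer) (simp_all add: invertible_det_nz)
    then show ?thesis by (simp add: column_def vec_eq_iff)
  qed
  have cont: "continuous_on S (\<lambda>M :: real^'n^'n. if j = k then c else M $ i $ j)" for S j k i c
    by (cases "j = k") (auto intro!: continuous_intros)
  have "continuous_on {M. invertible M} (\<lambda>M :: real^'n^'n. \<chi> k l.
      det (\<chi> i j. if j = k then axis l 1 $ i else M $ i $ j) / det M)"
    by (intro continuous_on_vec_lambda continuous_on_divide continuous_on_det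
        continuous_on_compose2[OF continuous_on_det[of UNIV]] cont)
      (auto simp: invertible_det_nz)
  then show ?thesis
    by (rule continuous_on_eq) (simp add: vec_eq_iff entry)
qed

text \<open>By the resolvent identity the remainder is exactly
  \<open>- (M^-1 (X - M) (X^-1 - M^-1))\<close>. Divided by \<open>norm (X - M)\<close> it is at
  most a multiple of \<open>norm (X^-1 - M^-1)\<close>, which tends to 0 by continuity of
  inversion.\<close>

lemma has_derivative_matrix_inv:
  fixes M :: "real^'n^'n"
  assumes "invertible M"
  shows "(matrix_inv has_derivative (\<lambda>H. - (matrix_inv M ** H ** matrix_inv M))) (at M)"
proof -
  interpret mult: bounded_bilinear "(**) :: real^'n^'n \<Rightarrow> real^'n^'n \<Rightarrow> _"
    by (rule bounded_bilinear_matrix_mult)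
  let ?N = "matrix_inv M"
  obtain b where b: "b > 0" "\<And>(X :: real^'n^'n) (Y :: real^'n^'n). norm (X ** Y) \<le> norm X * norm Y * b"
    using mult.pos_bounded by blast
  have ev: "eventually (\<lambda>X. invertible X) (at M)"
    using assms open_invertible by (simp add: eventually_at_topological) blast
  have lim: "(matrix_inv \<longlongrightarrow> ?N) (at M)"
    using continuous_on_matrix_inv[unfolded continuous_on_eq_continuous_at[OF open_invertible]] assms
    by (intro isContD) blast
  have key: "matrix_inv X - ?N + ?N ** (X - M) ** ?N = - (?N ** (X - M) ** (matrix_inv X - ?N))"
    if "invertible X" for X
  proof -
    have "?N ** (X - M) ** matrix_inv X = ?N - matrix_inv X"
      by (simp add: mult.diff_left mult.diff_right matrix_inv_left[OF assms]
          matrix_mul_assoc[symmetric] matrix_inv_right[OF that])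
    then show ?thesis by (simp add: mult.diff_right)
  qed
  have bl: "bounded_linear (\<lambda>H. - (?N ** H ** ?N))"
    by (intro bounded_linear_minus bounded_linear_compose[OF mult.bounded_linear_left]
        mult.bounded_linear_right)
  have "((\<lambda>X. norm ?N * b * norm (matrix_inv X - ?N) * b) \<longlongrightarrow> norm ?N * b * norm (?N - ?N) * b) (at M)"
    by (intro tendsto_intros lim)
  then have z: "((\<lambda>X. norm ?N * b * norm (matrix_inv X - ?N) * b) \<longlongrightarrow> 0) (at M)" by simp
  have "((\<lambda>X. norm (matrix_inv X - ?N + ?N ** (X - M) ** ?N) / norm (X - M)) \<longlongrightarrow> 0) (at M)"
  proof (rule Lim_null_comparison[OF _ z])
    show "\<forall>\<^sub>F X in at M. norm (norm (matrix_inv X - ?N + ?N ** (X - M) ** ?N) / norm (X - M))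
        \<le> norm ?N * b * norm (matrix_inv X - ?N) * b"
      using ev eventually_neq_at_within[of M]
    proof eventually_elim
      case (elim X)
      have "norm (?N ** (X - M) ** (matrix_inv X - ?N))
          \<le> norm (?N ** (X - M)) * norm (matrix_inv X - ?N) * b" by (rule b)
      also have "\<dots> \<le> norm ?N * norm (X - M) * b * norm (matrix_inv X - ?N) * b"
        using b by (intro mult_right_mono) auto
      finally show ?case
        unfolding key[OF elim(1)] using elim(2) by (simp add: divide_le_eq ac_simps)
    qed
  qed
  then show ?thesis
    by (simp add: has_derivative_iff_norm bl)
qed

section \<open>Calculus of \<open>k\<close> times continuously differentiable maps relative to a
  subspace\<close>

lemma Ck_on_Suc_imp: "Ck_on (Suc k) E U f \<Longrightarrow> Ck_on k E U f"
proof (induction k arbitrary: f)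
  case 0
  then show ?case
    by (auto simp: continuous_on_eq_continuous_within intro: has_derivative_continuous)
next
  case (Suc k)
  obtain f' where "\<forall>x\<in>U. (f has_derivative f' x) (at x within U)"
    and "\<forall>v\<in>E. Ck_on (Suc k) E U (\<lambda>x. f' x v)"
    using Suc.prems by (subst (asm) Ck_on.simps(2)) blast
  with Suc.IH show ?case by (subst Ck_on.simps(2)) blast
qed

lemma Ck_on_const: "Ck_on k E U (\<lambda>x. c)"
proof (induction k arbitrary: c)
  case (Suc k)
  then show ?case by (auto intro!: exI[of _ "\<lambda>x v. 0"])
qed simp

lemma Ck_on_bounded_linear: "bounded_linear f \<Longrightarrow> Ck_on k E U f"
  by (cases k) (auto intro!: linear_continuous_on exI[of _ "\<lambda>x. f"] Ck_on_const
      bounded_linear_imp_has_derivative)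

lemma Ck_on_add: "Ck_on k E U f \<Longrightarrow> Ck_on k E U g \<Longrightarrow> Ck_on k E U (\<lambda>x. f x + g x)"
proof (induction k arbitrary: f g)
  case (Suc k)
  obtain f' g' where "\<forall>x\<in>U. (f has_derivative f' x) (at x within U)"
      "\<forall>v\<in>E. Ck_on k E U (\<lambda>x. f' x v)" "\<forall>x\<in>U. (g has_derivative g' x) (at x within U)"
      "\<forall>v\<in>E. Ck_on k E U (\<lambda>x. g' x v)"
    using Suc.prems by auto
  with Suc.IH show ?case
    by (auto intro!: exI[of _ "\<lambda>x v. f' x v + g' x v"] has_derivative_add)
qed (simp add: continuous_on_add)

text \<open>The product rule leaves one factor undifferentiated in each term, so the induction also
  needs \<open>f\<close> and \<open>g\<close> themselves at order \<open>k\<close>;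
  \<open>Ck_on_Suc_imp\<close> provides this.\<close>

lemma (in bounded_bilinear) Ck_on:
  "Ck_on k E U f \<Longrightarrow> Ck_on k E U g \<Longrightarrow> Ck_on k E U (\<lambda>x. prod (f x) (g x))"
proof (induction k arbitrary: f g)
  case (Suc k)
  obtain f' g' where f': "\<forall>x\<in>U. (f has_derivative f' x) (at x within U)"
      "\<forall>v\<in>E. Ck_on k E U (\<lambda>x. f' x v)" and g': "\<forall>x\<in>U. (g has_derivative g' x) (at x within U)"
      "\<forall>v\<in>E. Ck_on k E U (\<lambda>x. g' x v)"
    using Suc.prems by auto
  show ?case
    unfolding Ck_on.simps(2)
    using f' g' Suc.prems[THEN Ck_on_Suc_imp] Suc.IH
    by (intro exI[of _ "\<lambda>x v. prod (f x) (g' x v) + prod (f' x v) (g x)"])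
      (auto intro!: FDERIV Ck_on_add)
qed (simp add: continuous_on)

lemma Ck_on_Pair: "Ck_on k E U f \<Longrightarrow> Ck_on k E U g \<Longrightarrow> Ck_on k E U (\<lambda>x. (f x, g x))"
proof (induction k arbitrary: f g)
  case (Suc k)
  obtain f' g' where "\<forall>x\<in>U. (f has_derivative f' x) (at x within U)"
      "\<forall>v\<in>E. Ck_on k E U (\<lambda>x. f' x v)" "\<forall>x\<in>U. (g has_derivative g' x) (at x within U)"
      "\<forall>v\<in>E. Ck_on k E U (\<lambda>x. g' x v)"
    using Suc.prems by auto
  with Suc.IH show ?case
    by (auto intro!: exI[of _ "\<lambda>x v. (f' x v, g' x v)"] has_derivative_Pair)
qed (simp add: continuous_on_Pair)

text \<open>The derivative of inversion is again a product of inverses with a fixed matrix, so the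
  induction on \<open>k\<close> closes. Because \<open>L\<close> is linear, \<open>L v\<close> does
  not depend on \<open>x\<close>, which avoids a general chain rule; the maps below only invert a
  coordinate.\<close>

lemma Ck_on_matrix_inv:
  fixes L :: "'a::real_normed_vector \<Rightarrow> real^'n^'n"
  assumes L: "bounded_linear L" and inv: "\<And>x. x \<in> U \<Longrightarrow> invertible (L x)"
  shows "Ck_on k E U (\<lambda>x. matrix_inv (L x))"
proof (induction k)
  case 0
  then show ?case
    using inv by (auto intro!: continuous_on_compose2[OF continuous_on_matrix_inv]
        linear_continuous_on[OF L])
next
  case (Suc k)
  have "((\<lambda>x. matrix_inv (L x)) has_derivative
      (\<lambda>v. - (matrix_inv (L x) ** L v ** matrix_inv (L x)))) (at x within U)" if "x \<in> U" for x
    using has_derivative_compose[OF bounded_linear_imp_has_derivative[OF L]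
        has_derivative_matrix_inv[OF inv[OF that]]] .
  moreover have "Ck_on k E U (\<lambda>x. - (matrix_inv (L x) ** L v ** matrix_inv (L x)))" for v
  proof -
    \<comment> \<open>The sign is absorbed into the constant factor, so that the product rule alone
      suffices.\<close>
    have "Ck_on k E U (\<lambda>x. matrix_inv (L x) ** ((- L v) ** matrix_inv (L x)))"
      by (intro bounded_bilinear.Ck_on[OF bounded_bilinear_matrix_mult] Suc Ck_on_const)
    moreover have "matrix_inv (L x) ** ((- L v) ** matrix_inv (L x))
        = - (matrix_inv (L x) ** L v ** matrix_inv (L x))" for x
      by (simp add: matrix_mul_assoc bounded_bilinear.minus_left[OF bounded_bilinear_matrix_mult]
          bounded_bilinear.minus_right[OF bounded_bilinear_matrix_mult])
    ultimately show ?thesis by simp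
  qed
  ultimately show ?case
    unfolding Ck_on.simps(2)
    by (intro exI[of _ "\<lambda>x v. - (matrix_inv (L x) ** L v ** matrix_inv (L x))"]) simp
qed

section \<open>Smoothness of the change of variables in both directions\<close>

lemma inf_differentiable_on_Phi:
  assumes "D \<subseteq> ambient_lft" "\<And>K \<gamma> P. (K, \<gamma>, P) \<in> D \<Longrightarrow> invertible P"
  shows "inf_differentiable_on ambient_lft ambient_cvx D
    (\<Phi> :: (real^'x^'u) \<times> real \<times> (real^'x^'x) \<Rightarrow> _)"
proof -
  let ?V = "UNIV \<times> UNIV \<times> {P :: real^'x^'x. invertible P} :: ((real^'x^'u) \<times> real \<times> (real^'x^'x)) set"
  have bl: "bounded_linear (\<lambda>x :: (real^'x^'u) \<times> real \<times> (real^'x^'x). snd (snd x))"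
    "bounded_linear (\<lambda>x :: (real^'x^'u) \<times> real \<times> (real^'x^'x). fst (snd x))"
    "bounded_linear (\<lambda>x :: (real^'x^'u) \<times> real \<times> (real^'x^'x). fst x)"
    by (intro bounded_linear_fst_comp bounded_linear_snd_comp bounded_linear_fst bounded_linear_snd)+
  \<comment> \<open>The formula for \<open>\<Phi>\<close> makes sense for every invertible symmetric
    \<open>P\<close>, and these form a relatively open set; hence \<open>\<Phi>\<close> serves as
    its own extension.\<close>
  have "open ?V" by (intro open_Times open_UNIV open_invertible)
  then have "openin (top_of_set ambient_lft) (ambient_lft \<inter> ?V)"
    by (rule openin_open_Int)
  moreover have "\<Phi> ` (ambient_lft \<inter> ?V) \<subseteq> ambient_cvx"
    by (auto simp: \<Phi>_def ambient_lft_def ambient_cvx_def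
        intro!: symmetric_mat_scaleR symmetric_mat_matrix_inv)
  moreover have "Ck_on k ambient_lft (ambient_lft \<inter> ?V) \<Phi>" for k
    unfolding \<Phi>_def case_prod_unfold
    by (intro Ck_on_Pair Ck_on_bounded_linear bl bounded_bilinear.Ck_on[OF bounded_bilinear_scaleR]
        bounded_bilinear.Ck_on[OF bounded_bilinear_matrix_mult] Ck_on_matrix_inv) auto
  moreover have "D \<subseteq> ambient_lft \<inter> ?V" using assms by auto
  ultimately show ?thesis
    unfolding inf_differentiable_on_def
    by (intro exI[of _ "ambient_lft \<inter> ?V"] exI[of _ \<Phi>]) simp
qed

text \<open>The inverse of \<open>\<Phi>\<close>, found by solving \<open>X = \<gamma> P^-1\<close>
  and \<open>Y = K X\<close> for \<open>P\<close> and \<open>K\<close>.\<close>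

definition \<Psi> :: "real \<times> (real^'x^'u) \<times> (real^'x^'x) \<Rightarrow> (real^'x^'u) \<times> real \<times> (real^'x^'x)" where
  "\<Psi> = (\<lambda>(\<gamma>, Y, X). (Y ** matrix_inv X, \<gamma>, \<gamma> *\<^sub>R matrix_inv X))"

text \<open>A general \<open>f\<close> is allowed because the result is applied to
  \<open>inv_into\<close>, which is known to agree with \<open>\<Psi>\<close> only on the image of
  \<open>\<Phi>\<close>; the smooth extension is \<open>\<Psi>\<close>.\<close>

lemma inf_differentiable_on_Psi:
  assumes "D \<subseteq> ambient_cvx" "\<And>\<gamma> Y X. (\<gamma>, Y, X) \<in> D \<Longrightarrow> invertible X"
    and eq: "\<And>z. z \<in> D \<Longrightarrow> f z = \<Psi> z"
  shows "inf_differentiable_on ambient_cvx ambient_lft D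
    (f :: real \<times> (real^'x^'u) \<times> (real^'x^'x) \<Rightarrow> _)"
proof -
  let ?V = "UNIV \<times> UNIV \<times> {P :: real^'x^'x. invertible P} :: (real \<times> (real^'x^'u) \<times> (real^'x^'x)) set"
  have bl: "bounded_linear (\<lambda>x :: real \<times> (real^'x^'u) \<times> (real^'x^'x). snd (snd x))"
    "bounded_linear (\<lambda>x :: real \<times> (real^'x^'u) \<times> (real^'x^'x). fst (snd x))"
    "bounded_linear (\<lambda>x :: real \<times> (real^'x^'u) \<times> (real^'x^'x). fst x)"
    by (intro bounded_linear_fst_comp bounded_linear_snd_comp bounded_linear_fst bounded_linear_snd)+
  have "open ?V" by (intro open_Times open_UNIV open_invertible)
  then have "openin (top_of_set ambient_cvx) (ambient_cvx \<inter> ?V)"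
    by (rule openin_open_Int)
  moreover have "\<Psi> ` (ambient_cvx \<inter> ?V) \<subseteq> ambient_lft"
    by (auto simp: \<Psi>_def ambient_lft_def ambient_cvx_def
        intro!: symmetric_mat_scaleR symmetric_mat_matrix_inv)
  moreover have "Ck_on k ambient_cvx (ambient_cvx \<inter> ?V) \<Psi>" for k
    unfolding \<Psi>_def case_prod_unfold
    by (intro Ck_on_Pair Ck_on_bounded_linear bl bounded_bilinear.Ck_on[OF bounded_bilinear_scaleR]
        bounded_bilinear.Ck_on[OF bounded_bilinear_matrix_mult] Ck_on_matrix_inv) auto
  moreover have "D \<subseteq> ambient_cvx \<inter> ?V" using assms by auto
  ultimately show ?thesis
    unfolding inf_differentiable_on_def
    by (intro exI[of _ "ambient_cvx \<inter> ?V"] exI[of _ \<Psi>]) (simp add: eq)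
qed

subsection \<open>Block matrices and the change of variables\<close>

lemma inner_transpose_mult: "x \<bullet> (transpose M *v y) = (M *v x) \<bullet> y" for M :: "real^'n^'m"
  by (metis dot_lmul_matrix inner_commute transpose_matrix_vector)

lemma symmetric_mat_inner: "symmetric_mat M \<Longrightarrow> x \<bullet> (M *v y) = y \<bullet> (M *v x)" for M :: "real^'n^'n"
  by (metis inner_commute inner_transpose_mult symmetric_mat_def)

lemma pos_def_invertible:
  fixes M :: "real^'n^'n"
  assumes "pos_def M"
  shows "invertible M"
proof -
  have "M *v x = 0 \<Longrightarrow> x = 0" for x
    using assms unfolding pos_def_def by (metis inner_zero_right less_irrefl)
  then show ?thesis
    using matrix_left_invertible_ker invertible_left_inverse by blast
qed

lemma matrix_inv_mult_vec:
  assumes "invertible M"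
  shows "M *v (matrix_inv M *v x) = x" "matrix_inv M *v (M *v x) = x"
  using assms by (simp_all add: matrix_vector_mul_assoc matrix_inv_right matrix_inv_left)

lemma pos_def_matrix_inv:
  fixes M :: "real^'n^'n"
  assumes "pos_def M"
  shows "pos_def (matrix_inv M)"
  unfolding pos_def_def
proof (intro conjI allI impI)
  have inv: "invertible M" using assms by (rule pos_def_invertible)
  show sym: "symmetric_mat (matrix_inv M)"
    using assms inv by (simp add: pos_def_def symmetric_mat_matrix_inv)
  fix v :: "real^'n" assume "v \<noteq> 0"
  then have "matrix_inv M *v v \<noteq> 0" using matrix_inv_mult_vec(1)[OF inv, of v] by auto
  then have "0 < (matrix_inv M *v v) \<bullet> (M *v (matrix_inv M *v v))"
    using assms by (simp add: pos_def_def)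
  then show "0 < v \<bullet> (matrix_inv M *v v)"
    by (simp add: matrix_inv_mult_vec(1)[OF inv] inner_commute)
qed

lemma pos_def_scaleR: "pos_def M \<Longrightarrow> c > 0 \<Longrightarrow> pos_def (c *\<^sub>R M)" for M :: "real^'n^'n"
  by (auto simp: pos_def_def symmetric_mat_scaleR simp flip: scaleR_matrix_vector_assoc)

lemma pos_def_imp_semidef: "pos_def M \<Longrightarrow> pos_semidef M"
  unfolding pos_def_def pos_semidef_def by (metis inner_zero_left less_eq_real_def)

section \<open>Block vectors and the quadratic forms of the two block matrices\<close>

definition vjoin :: "'a^'m \<Rightarrow> 'a^'n \<Rightarrow> 'a^('m + 'n)" where
  "vjoin a b = (\<chi> i. case i of Inl k \<Rightarrow> a $ k | Inr l \<Rightarrow> b $ l)"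

lemma vjoin_surj:
  obtains a b where "v = vjoin a b"
proof
  show "v = vjoin (\<chi> k. v $ Inl k) (\<chi> l. v $ Inr l)"
    by (simp add: vjoin_def vec_eq_iff split: sum.split)
qed

lemma sum_UNIV_Plus: "(\<Sum>i\<in>UNIV. f i) = (\<Sum>k\<in>UNIV. f (Inl k)) + (\<Sum>l\<in>UNIV. f (Inr l))"
  for f :: "'m::finite + 'n::finite \<Rightarrow> 'b::comm_monoid_add"
  by (subst UNIV_Plus_UNIV[symmetric], subst sum.Plus) (simp_all)

lemma inner_vjoin: "vjoin a b \<bullet> vjoin c d = a \<bullet> c + b \<bullet> d"
  by (simp add: inner_vec_def sum_UNIV_Plus vjoin_def)

lemma vcat_mult_vec: "(M === N) *v v = vjoin (M *v v) (N *v v)"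
  by (simp add: vec_eq_iff vcat_def vjoin_def matrix_vector_mult_def split: sum.split)

lemma hcat_mult_vjoin: "(M ||| N) *v vjoin a b = M *v a + N *v b"
  by (simp add: vec_eq_iff hcat_def vjoin_def matrix_vector_mult_def sum_UNIV_Plus)

lemma transpose_vcat: "transpose (M === N) = transpose M ||| transpose N"
  by (simp add: vec_eq_iff hcat_def vcat_def transpose_def split: sum.split)

lemma transpose_hcat: "transpose (M ||| N) = transpose M === transpose N"
  by (simp add: vec_eq_iff hcat_def vcat_def transpose_def split: sum.split)

lemma hcat_vcat_interchange: "(M === N) ||| (M' === N') = (M ||| M') === (N ||| N')"
  by (simp add: vec_eq_iff hcat_def vcat_def split: sum.split)

lemma transpose_zero [simp]: "transpose 0 = 0"
  by (simp add: vec_eq_iff transpose_def)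

lemma transpose_add: "transpose (M + N) = transpose M + transpose N"
  by (simp add: vec_eq_iff transpose_def)

lemma transpose_diff: "transpose (M - N) = transpose M - transpose N" for M :: "'a::ab_group_add^'n^'m"
  by (simp add: vec_eq_iff transpose_def)

lemmas block_simps = transpose_vcat transpose_hcat hcat_vcat_interchange transpose_add
  transpose_diff transpose_scalar matrix_transpose_mul

lemma symmetric_mat_M_lft:
  fixes A :: "real^'x^'x" and B :: "real^'u^'x" and Bw :: "real^'w^'x"
  assumes "symmetric_mat Q" "symmetric_mat R" "symmetric_mat P"
  shows "symmetric_mat (M_lft A B Bw Q R K \<gamma> P)"
  using assms by (simp add: M_lft_def symmetric_mat_def block_simps matrix_mul_assoc)

lemma symmetric_mat_M_cvx:
  fixes A :: "real^'x^'x" and B :: "real^'u^'x" and Bw :: "real^'w^'x"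
  assumes "pos_def Q" "pos_def R" "symmetric_mat X"
  shows "symmetric_mat (M_cvx A B Bw Q R \<gamma> Y X)"
proof -
  have "transpose (matrix_inv Q) = matrix_inv Q" "transpose (matrix_inv R) = matrix_inv R"
    using pos_def_matrix_inv[OF assms(1)] pos_def_matrix_inv[OF assms(2)]
    by (simp_all add: pos_def_def symmetric_mat_def)
  with assms(3) show ?thesis
    by (simp add: M_cvx_def symmetric_mat_def block_simps)
qed

text \<open>Read with state \<open>z\<close> and disturbance \<open>b\<close>, this is one step of
  the dissipation inequality: new storage minus old storage, plus stage cost, minus supplied
  energy.\<close>

lemma M_lft_form:
  fixes A :: "real^'x^'x" and B :: "real^'u^'x" and Bw :: "real^'w^'x"
  shows "vjoin z b \<bullet> (M_lft A B Bw Q R K \<gamma> P *v vjoin z b) =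
    ((A + B ** K) *v z + Bw *v b) \<bullet> (P *v ((A + B ** K) *v z + Bw *v b)) - z \<bullet> (P *v z)
    + z \<bullet> ((Q + transpose K ** R ** K) *v z) - \<gamma>\<^sup>2 * (b \<bullet> b)"
proof -
  define F where "F = A + B ** K"
  show ?thesis
    unfolding M_lft_def F_def[symmetric]
    by (simp add: vcat_mult_vec hcat_mult_vjoin inner_vjoin matrix_vector_mult_add_rdistrib
        matrix_vector_mult_diff_rdistrib matrix_vector_right_distrib inner_add_left inner_add_right
        inner_diff_right inner_transpose_mult matrix_vector_mul_assoc[symmetric]
        scaleR_matrix_vector_assoc[symmetric]
        del: transpose_matrix_vector)
qed

text \<open>The brackets collect the terms in \<open>c\<close>, in \<open>d\<close> and in
  \<open>e\<close>, ready for completing the square in each. The two mixed terms in \<open>d\<close>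
  coincide once \<open>X\<close> is symmetric.\<close>

lemma M_cvx_form:
  fixes A :: "real^'x^'x" and B :: "real^'u^'x" and Bw :: "real^'w^'x"
  shows "vjoin a (vjoin b (vjoin c (vjoin d e))) \<bullet>
      (M_cvx A B Bw Q R \<gamma> Y X *v vjoin a (vjoin b (vjoin c (vjoin d e)))) =
    a \<bullet> (X *v a) + \<gamma> * (b \<bullet> b)
    + (c \<bullet> (X *v c) + 2 * (c \<bullet> ((A ** X + B ** Y) *v a + Bw *v b)))
    + (\<gamma> * (d \<bullet> (matrix_inv Q *v d)) + d \<bullet> (X *v a) + a \<bullet> (X *v d))
    + (\<gamma> * (e \<bullet> (matrix_inv R *v e)) + 2 * (e \<bullet> (Y *v a)))"
proof -
  define G where "G = A ** X + B ** Y"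
  have "(G *v a) \<bullet> c = c \<bullet> (G *v a)" "(Bw *v b) \<bullet> c = c \<bullet> (Bw *v b)" "(Y *v a) \<bullet> e = e \<bullet> (Y *v a)"
    by (simp_all add: inner_commute)
  then show ?thesis
    unfolding M_cvx_def G_def[symmetric]
    by (simp add: vcat_mult_vec hcat_mult_vjoin inner_vjoin inner_add_left inner_add_right
        inner_diff_right inner_transpose_mult scaleR_matrix_vector_assoc[symmetric]
        del: transpose_matrix_vector)
qed

text \<open>As a function of \<open>d\<close> the left side is minimal at
  \<open>d = - (1 / \<gamma>) M z\<close>; the minimum is the contribution of this block to the
  Schur complement.\<close>

lemma complete_square_inverse:
  fixes M :: "real^'n^'n"
  assumes "pos_def M" "\<gamma> > 0"
  shows "\<gamma> * (d \<bullet> (matrix_inv M *v d)) + 2 * (d \<bullet> z) =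
    \<gamma> * ((d + (1 / \<gamma>) *\<^sub>R (M *v z)) \<bullet> (matrix_inv M *v (d + (1 / \<gamma>) *\<^sub>R (M *v z))))
    - (1 / \<gamma>) * (z \<bullet> (M *v z))"
proof -
  have inv: "invertible M" using assms(1) by (rule pos_def_invertible)
  have "(M *v z) \<bullet> (matrix_inv M *v d) = d \<bullet> z"
    using symmetric_mat_inner[of "matrix_inv M" "M *v z" d] pos_def_matrix_inv[OF assms(1)]
    by (simp add: pos_def_def matrix_inv_mult_vec[OF inv])
  then show ?thesis
    using assms(2)
    by (simp add: matrix_vector_right_distrib matrix_vector_mult_scaleR inner_add_left inner_add_right
        matrix_inv_mult_vec[OF inv] inner_commute[of "M *v z" z] field_simps)
qed

text \<open>As \<open>X = \<gamma> P^-1\<close>, the variables \<open>c\<close>, \<open>d\<close>,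
  \<open>e\<close> carry the blocks \<open>\<gamma> P^-1\<close>, \<open>\<gamma> Q^-1\<close>,
  \<open>\<gamma> R^-1\<close>, so \<open>complete_square_inverse\<close> applies to each. What is
  left is the other form, negated and scaled, in the variable \<open>z = X a\<close>.\<close>

lemma M_cvx_form_complete_squares:
  fixes A :: "real^'x^'x" and B :: "real^'u^'x" and Bw :: "real^'w^'x"
  assumes "pos_def Q" "pos_def R" "pos_def P" "\<gamma> > 0"
    and X: "X = \<gamma> *\<^sub>R matrix_inv P" and Y: "Y = K ** X"
    and z: "z = X *v a" and y: "y = (A + B ** K) *v z + Bw *v b"
  shows "vjoin a (vjoin b (vjoin c (vjoin d e))) \<bullet>
      (M_cvx A B Bw Q R \<gamma> Y X *v vjoin a (vjoin b (vjoin c (vjoin d e)))) =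
    - (1 / \<gamma>) * (vjoin z b \<bullet> (M_lft A B Bw Q R K \<gamma> P *v vjoin z b))
    + \<gamma> * ((c + (1 / \<gamma>) *\<^sub>R (P *v y)) \<bullet> (matrix_inv P *v (c + (1 / \<gamma>) *\<^sub>R (P *v y))))
    + \<gamma> * ((d + (1 / \<gamma>) *\<^sub>R (Q *v z)) \<bullet> (matrix_inv Q *v (d + (1 / \<gamma>) *\<^sub>R (Q *v z))))
    + \<gamma> * ((e + (1 / \<gamma>) *\<^sub>R (R *v (K *v z))) \<bullet> (matrix_inv R *v (e + (1 / \<gamma>) *\<^sub>R (R *v (K *v z)))))"
proof -
  have inv: "invertible P" using assms(3) by (rule pos_def_invertible)
  have symX: "symmetric_mat X"
    using pos_def_scaleR[OF pos_def_matrix_inv[OF assms(3)] assms(4)] by (simp add: X pos_def_def)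
  \<comment> \<open>Here \<open>(1 / \<gamma>) P\<close> is the inverse of \<open>X\<close>.\<close>
  have a: "a = (1 / \<gamma>) *\<^sub>R (P *v z)"
    using \<open>\<gamma> > 0\<close>
    by (simp add: z X matrix_vector_mult_scaleR matrix_inv_mult_vec[OF inv]
        scaleR_matrix_vector_assoc[symmetric])
  have "a \<bullet> (X *v a) = (1 / \<gamma>) * (z \<bullet> (P *v z))"
    by (subst a) (simp add: z inner_commute)
  moreover have "(A ** X + B ** Y) *v a + Bw *v b = y"
    by (simp add: y z Y matrix_vector_mult_add_rdistrib matrix_vector_mul_assoc[symmetric])
  moreover have "Y *v a = K *v z" by (simp add: Y z matrix_vector_mul_assoc[symmetric])
  moreover have "c \<bullet> (X *v c) = \<gamma> * (c \<bullet> (matrix_inv P *v c))"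
    by (simp add: X scaleR_matrix_vector_assoc[symmetric])
  moreover have "d \<bullet> (X *v a) + a \<bullet> (X *v d) = 2 * (d \<bullet> z)"
    using symmetric_mat_inner[OF symX, of a d] by (simp add: z)
  ultimately have "vjoin a (vjoin b (vjoin c (vjoin d e))) \<bullet>
      (M_cvx A B Bw Q R \<gamma> Y X *v vjoin a (vjoin b (vjoin c (vjoin d e)))) =
    (1 / \<gamma>) * (z \<bullet> (P *v z)) + \<gamma> * (b \<bullet> b)
    + (\<gamma> * (c \<bullet> (matrix_inv P *v c)) + 2 * (c \<bullet> y))
    + (\<gamma> * (d \<bullet> (matrix_inv Q *v d)) + 2 * (d \<bullet> z))
    + (\<gamma> * (e \<bullet> (matrix_inv R *v e)) + 2 * (e \<bullet> (K *v z)))"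
    unfolding M_cvx_form by simp
  moreover have "- (1 / \<gamma>) * (vjoin z b \<bullet> (M_lft A B Bw Q R K \<gamma> P *v vjoin z b))
    = (1 / \<gamma>) * (z \<bullet> (P *v z)) + \<gamma> * (b \<bullet> b) - (1 / \<gamma>) * (y \<bullet> (P *v y))
     - (1 / \<gamma>) * (z \<bullet> (Q *v z)) - (1 / \<gamma>) * ((K *v z) \<bullet> (R *v (K *v z)))"
    unfolding M_lft_form y[symmetric]
    using \<open>\<gamma> > 0\<close>
    by (simp add: matrix_vector_mult_add_rdistrib inner_add_right matrix_vector_mul_assoc[symmetric]
        inner_transpose_mult field_simps power2_eq_square del: transpose_matrix_vector)
  ultimately show ?thesis
    unfolding complete_square_inverse[OF assms(3,4)] complete_square_inverse[OF assms(1,4)]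
      complete_square_inverse[OF assms(2,4)] by simp
qed

lemma loewner_le_0_M_lft_iff:
  fixes A :: "real^'x^'x" and B :: "real^'u^'x" and Bw :: "real^'w^'x"
  assumes "symmetric_mat Q" "symmetric_mat R" "symmetric_mat P"
  shows "M_lft A B Bw Q R K \<gamma> P \<preceq>\<^sub>L 0 \<longleftrightarrow>
    (\<forall>z b. vjoin z b \<bullet> (M_lft A B Bw Q R K \<gamma> P *v vjoin z b) \<le> 0)"
proof -
  have "symmetric_mat (0 - M_lft A B Bw Q R K \<gamma> P)"
    using symmetric_mat_M_lft[OF assms] by (metis symmetric_mat_def transpose_diff transpose_zero)
  then show ?thesis
    unfolding loewner_le_def pos_semidef_def matrix_vector_mult_diff_rdistrib
    by (simp add: inner_diff_right) (metis vjoin_surj)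
qed

text \<open>In the completed-squares identity the three squares are nonnegative, which gives one
  direction. For the other, the squares can be made to vanish while \<open>b\<close> and, as
  \<open>X\<close> is invertible, \<open>z\<close> stay arbitrary.\<close>

lemma M_lft_M_cvx_equiv:
  fixes A :: "real^'x^'x" and B :: "real^'u^'x" and Bw :: "real^'w^'x"
  assumes Q: "pos_def Q" and R: "pos_def R" and P: "pos_def P" and \<gamma>: "\<gamma> > 0"
    and X: "X = \<gamma> *\<^sub>R matrix_inv P" and Y: "Y = K ** X"
  shows "M_lft A B Bw Q R K \<gamma> P \<preceq>\<^sub>L 0 \<longleftrightarrow> 0 \<preceq>\<^sub>L M_cvx A B Bw Q R \<gamma> Y X"
proof -
  note squares = M_cvx_form_complete_squares[OF Q R P \<gamma> X Y refl refl]
  have inv: "invertible P" using P by (rule pos_def_invertible)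
  have sym: "symmetric_mat Q" "symmetric_mat R" "symmetric_mat P"
    using Q R P by (auto simp: pos_def_def)
  have symX: "symmetric_mat X"
    using pos_def_scaleR[OF pos_def_matrix_inv[OF P] \<gamma>] by (simp add: X pos_def_def)
  have nonneg: "v \<bullet> (matrix_inv M *v v) \<ge> 0" if "pos_def M" for M :: "real^'n^'n" and v
    using pos_def_imp_semidef[OF pos_def_matrix_inv[OF that]] by (simp add: pos_semidef_def)
  show ?thesis
  proof
    assume "M_lft A B Bw Q R K \<gamma> P \<preceq>\<^sub>L 0"
    then have le: "vjoin z b \<bullet> (M_lft A B Bw Q R K \<gamma> P *v vjoin z b) \<le> 0" for z b
      by (simp add: loewner_le_0_M_lft_iff[OF sym])
    have "v \<bullet> (M_cvx A B Bw Q R \<gamma> Y X *v v) \<ge> 0" for v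
    proof -
      obtain a b c d e where v: "v = vjoin a (vjoin b (vjoin c (vjoin d e)))"
        by (metis vjoin_surj)
      show ?thesis
        unfolding v squares using \<gamma> le
        by (intro add_nonneg_nonneg mult_nonpos_nonpos mult_nonneg_nonneg[of \<gamma>] nonneg P Q R) simp_all
    qed
    then show "0 \<preceq>\<^sub>L M_cvx A B Bw Q R \<gamma> Y X"
      by (simp add: loewner_le_def pos_semidef_def symmetric_mat_M_cvx[OF Q R symX])
  next
    assume "0 \<preceq>\<^sub>L M_cvx A B Bw Q R \<gamma> Y X"
    then have ge: "v \<bullet> (M_cvx A B Bw Q R \<gamma> Y X *v v) \<ge> 0" for v
      by (simp add: loewner_le_def pos_semidef_def)
    have "vjoin z b \<bullet> (M_lft A B Bw Q R K \<gamma> P *v vjoin z b) \<le> 0" for z b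
    proof -
      define a where "a = (1 / \<gamma>) *\<^sub>R (P *v z)"
      have z: "X *v a = z"
        using \<gamma> by (simp add: a_def X matrix_vector_mult_scaleR matrix_inv_mult_vec[OF inv]
            scaleR_matrix_vector_assoc[symmetric])
      define y where "y = (A + B ** K) *v z + Bw *v b"
      \<comment> \<open>The last three blocks are chosen at the minimizers, where all three squares
        are zero.\<close>
      have "0 \<le> - (1 / \<gamma>) * (vjoin z b \<bullet> (M_lft A B Bw Q R K \<gamma> P *v vjoin z b))"
        using ge[of "vjoin a (vjoin b (vjoin (- ((1 / \<gamma>) *\<^sub>R (P *v y)))
          (vjoin (- ((1 / \<gamma>) *\<^sub>R (Q *v z))) (- ((1 / \<gamma>) *\<^sub>R (R *v (K *v z)))))))"]
        unfolding squares z y_def[symmetric] by simp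
      then show ?thesis using \<gamma> by (simp add: zero_le_mult_iff field_simps)
    qed
    then show "M_lft A B Bw Q R K \<gamma> P \<preceq>\<^sub>L 0"
      by (simp add: loewner_le_0_M_lft_iff[OF sym])
  qed
qed

lemma Psi_Phi: "\<gamma> > 0 \<Longrightarrow> pos_def P \<Longrightarrow> \<Psi> (\<Phi> (K, \<gamma>, P)) = (K, \<gamma>, P)"
  using pos_def_invertible[of P]
  by (simp add: \<Phi>_def \<Psi>_def matrix_inv_scaleR invertible_matrix_inv matrix_inv_matrix_inv
      matrix_mul_scaleR_left matrix_mul_scaleR_right matrix_mul_assoc[symmetric] matrix_inv_left)

lemma Phi_Psi: "\<gamma> > 0 \<Longrightarrow> pos_def X \<Longrightarrow> \<Phi> (\<Psi> (\<gamma>, Y, X)) = (\<gamma>, Y, X)"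
  using pos_def_invertible[of X]
  by (simp add: \<Phi>_def \<Psi>_def matrix_inv_scaleR invertible_matrix_inv matrix_inv_matrix_inv
      matrix_mul_scaleR_left matrix_mul_scaleR_right matrix_mul_assoc[symmetric] matrix_inv_left)

lemma Phi_mem_F_cvx:
  assumes "pos_def Q" "pos_def R" "p \<in> L_lft A B Bw Q R"
  shows "\<Phi> p \<in> F_cvx A B Bw Q R"
proof -
  obtain K \<gamma> P where p: "p = (K, \<gamma>, P)" "\<gamma> > 0" "pos_def P" "M_lft A B Bw Q R K \<gamma> P \<preceq>\<^sub>L 0"
    using assms(3) by (auto simp: L_lft_def)
  then show ?thesis
    using M_lft_M_cvx_equiv[OF assms(1,2) p(3,2) refl refl, of A B Bw K]
    by (simp add: \<Phi>_def F_cvx_def pos_def_scaleR pos_def_matrix_inv matrix_mul_scaleR_right)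
qed

lemma Psi_mem_L_lft:
  assumes "pos_def Q" "pos_def R" "q \<in> F_cvx A B Bw Q R"
  shows "\<Psi> q \<in> L_lft A B Bw Q R"
proof -
  obtain \<gamma> Y X where q: "q = (\<gamma>, Y, X)" "\<gamma> > 0" "pos_def X" "0 \<preceq>\<^sub>L M_cvx A B Bw Q R \<gamma> Y X"
    using assms(3) by (auto simp: F_cvx_def)
  have P: "pos_def (\<gamma> *\<^sub>R matrix_inv X)" by (simp add: q pos_def_scaleR pos_def_matrix_inv)
  have "\<Phi> (\<Psi> (\<gamma>, Y, X)) = (\<gamma>, Y, X)" using Phi_Psi q by blast
  then have "X = \<gamma> *\<^sub>R matrix_inv (\<gamma> *\<^sub>R matrix_inv X)" by (simp add: \<Psi>_def \<Phi>_def)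
  moreover have "Y = (Y ** matrix_inv X) ** X"
    using pos_def_invertible[OF q(3)] by (simp add: matrix_mul_assoc[symmetric] matrix_inv_left)
  ultimately show ?thesis
    using M_lft_M_cvx_equiv[OF assms(1,2) P q(2), of X Y "Y ** matrix_inv X" A B Bw] q P
    by (simp add: \<Psi>_def L_lft_def)
qed

lemma bij_betw_Phi:
  assumes "pos_def Q" "pos_def R"
  shows "bij_betw \<Phi> (L_lft A B Bw Q R) (F_cvx A B Bw Q R)"
proof (rule bij_betw_byWitness[where f' = \<Psi>])
  show "\<forall>p\<in>L_lft A B Bw Q R. \<Psi> (\<Phi> p) = p" by (auto simp: L_lft_def Psi_Phi)
  show "\<forall>q\<in>F_cvx A B Bw Q R. \<Phi> (\<Psi> q) = q" by (auto simp: F_cvx_def Phi_Psi)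
qed (use assms Phi_mem_F_cvx Psi_mem_L_lft in blast)+

subsection \<open>Orbits of Schur stable matrices\<close>

text \<open>Telescoping. The induction keeps the nonnegative end term \<open>a T\<close>, which is
  dropped afterwards.\<close>

lemma sum_recurrence_le:
  fixes a b :: "nat \<Rightarrow> real"
  assumes "\<And>t. a (Suc t) \<le> \<rho> * a t + b t" and "\<And>t. 0 \<le> a t"
  shows "(1 - \<rho>) * (\<Sum>t<T. a t) \<le> a 0 + (\<Sum>t<T. b t)"
proof -
  have "(1 - \<rho>) * (\<Sum>t<T. a t) + a T \<le> a 0 + (\<Sum>t<T. b t)"
  proof (induction T)
    case (Suc T)
    then show ?case using assms(1)[of T] by (simp add: algebra_simps)
  qed simp
  then show ?thesis using assms(2)[of T] by linarith
qed

lemma summable_recurrence: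
  fixes a b :: "nat \<Rightarrow> real"
  assumes "\<And>t. a (Suc t) \<le> \<rho> * a t + b t" and "\<And>t. 0 \<le> a t" "\<And>t. 0 \<le> b t"
    and "summable b" "\<rho> < 1"
  shows "summable a"
proof (rule summableI_nonneg_bounded)
  fix T
  have "(\<Sum>t<T. b t) \<le> (\<Sum>t. b t)" using assms by (intro sum_le_suminf) auto
  then have "(1 - \<rho>) * (\<Sum>t<T. a t) \<le> a 0 + (\<Sum>t. b t)"
    using sum_recurrence_le[of a \<rho> b T] assms(1,2) by fastforce
  then show "(\<Sum>t<T. a t) \<le> (a 0 + (\<Sum>t. b t)) / (1 - \<rho>)"
    using \<open>\<rho> < 1\<close> by (simp add: field_simps)
qed (use assms in auto)

text \<open>The vector usually written \<open>p(M) v\<close>. Iterating on \<open>v\<close> instead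
  of forming powers of \<open>M\<close> links it directly to the orbit of \<open>v\<close>.\<close>

definition poly_act :: "complex^'n^'n \<Rightarrow> complex poly \<Rightarrow> complex^'n \<Rightarrow> complex^'n" where
  "poly_act M p v = (\<Sum>i\<le>degree p. coeff p i *s ((*v) M ^^ i) v)"

lemma poly_act_altdef:
  assumes "degree p \<le> n"
  shows "poly_act M p v = (\<Sum>i\<le>n. coeff p i *s ((*v) M ^^ i) v)"
  unfolding poly_act_def using assms
  by (intro sum.mono_neutral_left) (auto simp: coeff_eq_0)

lemma funpow_matrix_linear:
  fixes M :: "'a::field^'n^'n"
  shows "((*v) M ^^ i) (v + w) = ((*v) M ^^ i) v + ((*v) M ^^ i) w"
    and "((*v) M ^^ i) (v - w) = ((*v) M ^^ i) v - ((*v) M ^^ i) w"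
    and "((*v) M ^^ i) (c *s v) = c *s ((*v) M ^^ i) v"
  by (induction i)
    (simp_all add: matrix_vector_right_distrib matrix_vector_mult_diff_distrib vector_scalar_commute)

text \<open>A linear factor of the polynomial can be moved onto the vector; this lowers the degree
  in the induction on annihilating polynomials.\<close>

lemma poly_act_mult_linear:
  "poly_act M ([:- r, 1:] * q) v = poly_act M q (M *v v - r *s v)"
proof -
  let ?n = "degree q"
  have split: "(\<Sum>i\<le>Suc ?n. coeff (pCons 0 q) i *s ((*v) M ^^ i) v)
      = (\<Sum>i\<le>?n. coeff q i *s ((*v) M ^^ i) (M *v v))"
    by (subst sum.atMost_Suc_shift) (simp add: funpow_swap1)
  \<comment> \<open>The additional index contributes nothing, as it exceeds the degree of
    \<open>q\<close>.\<close>
  have shift: "(\<Sum>i\<le>Suc ?n. (r * coeff q i) *s ((*v) M ^^ i) v)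
      = r *s (\<Sum>i\<le>?n. coeff q i *s ((*v) M ^^ i) v)"
    by (simp add: coeff_eq_0 vec.scale_sum_right)
  have "degree ([:- r, 1:] * q) \<le> Suc ?n"
    using degree_mult_le[of "[:- r, 1:]" q] by simp
  moreover have "coeff ([:- r, 1:] * q) i = coeff (pCons 0 q) i - r * coeff q i" for i
    by simp
  ultimately have "poly_act M ([:- r, 1:] * q) v
      = (\<Sum>i\<le>?n. coeff q i *s ((*v) M ^^ i) (M *v v)) - r *s (\<Sum>i\<le>?n. coeff q i *s ((*v) M ^^ i) v)"
    by (simp only: poly_act_altdef split[symmetric] shift[symmetric] vec.scale_left_diff_distrib
        sum_subtractf)
  also have "\<dots> = poly_act M q (M *v v - r *s v)"
    by (simp add: poly_act_def funpow_matrix_linear vec.scale_sum_right sum_subtractf[symmetric]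
       vec.scale_right_diff_distrib mult.commute)
  finally show ?thesis .
qed

lemma poly_act_commute: "M *v poly_act M p v - r *s poly_act M p v = poly_act M p (M *v v - r *s v)"
proof -
  have "M *v poly_act M p v = poly_act M p (M *v v)"
    by (simp add: poly_act_def funpow_swap1 vec.linear_sum[OF matrix_vector_mul_linear_gen]
       vector_scalar_commute)
  moreover have "r *s poly_act M p v = poly_act M p (r *s v)"
    by (simp add: poly_act_def vec.scale_sum_right funpow_matrix_linear mult.commute)
  moreover have "poly_act M p (M *v v) - poly_act M p (r *s v) = poly_act M p (M *v v - r *s v)"
    by (simp add: poly_act_def funpow_matrix_linear sum_subtractf vec.scale_right_diff_distrib)
  ultimately show ?thesis by simp
qed

lemma norm_vector_scalar: "norm (c *s v) = cmod c * norm v" for v :: "complex^'n"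
  by (simp add: norm_vec_def norm_mult L2_set_right_distrib)

text \<open>Induction on the degree, splitting off a root \<open>r\<close> with cofactor
  \<open>q\<close>. If \<open>cmod r < 1\<close>, the orbit satisfies
  \<open>x (t + 1) = r x t + u t\<close>, where \<open>u\<close> is the orbit of
  \<open>M v - r v\<close>, annihilated by \<open>q\<close> and so summable. Otherwise
  \<open>q(M) v\<close> would be an eigenvector for \<open>r\<close> unless it is zero, so
  \<open>q\<close> already annihilates \<open>v\<close>. No Jordan form is involved.\<close>

lemma summable_orbit_of_annihilated:
  fixes M :: "complex^'n^'n"
  assumes "\<And>c z. z \<noteq> 0 \<Longrightarrow> M *v z = c *s z \<Longrightarrow> cmod c < 1"
    and "p \<noteq> 0" "poly_act M p v = 0"
  shows "summable (\<lambda>t. norm (((*v) M ^^ t) v))"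
  using assms(2,3)
proof (induction "degree p" arbitrary: p v)
  case 0
  then obtain a where "p = [:a:]" "a \<noteq> 0" by (metis degree_eq_zeroE pCons_0_0)
  then have "v = 0" using "0.prems" by (simp add: poly_act_def)
  moreover have "((*v) M ^^ t) 0 = 0" for t by (induction t) auto
  ultimately show ?case by simp
next
  case (Suc n)
  obtain r where "poly p r = 0"
    using fundamental_theorem_of_algebra[of p] Suc.hyps(2) by (metis constant_degree nat.simps(3))
  then obtain q where p: "p = [:- r, 1:] * q" by (metis dvdE poly_eq_0_iff_dvd)
  then have q0: "q \<noteq> 0" using Suc.prems(1) by auto
  then have "degree p = Suc (degree q)" unfolding p by (subst degree_mult_eq) auto
  with q0 have q: "q \<noteq> 0" "n = degree q" using Suc.hyps(2) by auto
  have u: "poly_act M q (M *v v - r *s v) = 0"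
    using Suc.prems(2) by (simp only: p poly_act_mult_linear)
  show ?case
  proof (cases "cmod r < 1")
    case True
    have IH: "summable (\<lambda>t. norm (((*v) M ^^ t) (M *v v - r *s v)))"
      using Suc.hyps(1)[OF q(2) q(1) u] .
    have step: "norm (((*v) M ^^ Suc t) v)
        \<le> cmod r * norm (((*v) M ^^ t) v) + norm (((*v) M ^^ t) (M *v v - r *s v))" for t
    proof -
      have "((*v) M ^^ Suc t) v = r *s ((*v) M ^^ t) v + ((*v) M ^^ t) (M *v v - r *s v)"
        by (simp add: funpow_swap1 funpow_matrix_linear)
      then show ?thesis
        using norm_triangle_ineq[of "r *s ((*v) M ^^ t) v" "((*v) M ^^ t) (M *v v - r *s v)"]
        by (simp only: norm_vector_scalar)
    qed
    show ?thesis by (rule summable_recurrence[OF step _ _ IH True]) simp_all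
  next
    case False
    have "M *v poly_act M q v = r *s poly_act M q v"
      using u poly_act_commute[of M q v r] by simp
    then have "poly_act M q v = 0" using assms(1) False by blast
    then show ?thesis using Suc.hyps(1) q by blast
  qed
qed

text \<open>The \<open>DIM + 1\<close> iterates with index up to \<open>DIM\<close>, if distinct,
  are linearly dependent over the reals, and the coefficients of a dependence form the polynomial.
  If two iterates coincide, a difference of monomials does.\<close>

lemma ex_annihilating_poly:
  fixes M :: "complex^'n^'n"
  shows "\<exists>p. p \<noteq> 0 \<and> poly_act M p v = 0"
proof (cases "inj_on (\<lambda>i. ((*v) M ^^ i) v) {..DIM(complex^'n)}")
  case True
  let ?g = "\<lambda>i. ((*v) M ^^ i) v" and ?N = "DIM(complex^'n)"
  have "dependent (?g ` {..?N})"
    using True by (intro dependent_biggerset) (simp add: card_image)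
  then obtain c where c: "(\<Sum>x\<in>?g ` {..?N}. c x *\<^sub>R x) = 0" "\<exists>x\<in>?g ` {..?N}. c x \<noteq> 0"
    by (subst (asm) dependent_finite) auto
  define p where "p = (\<Sum>i\<le>?N. monom (complex_of_real (c (?g i))) i)"
  have coeff: "coeff p i = (if i \<le> ?N then complex_of_real (c (?g i)) else 0)" for i
    by (simp add: p_def coeff_sum)
  have "degree p \<le> ?N" by (rule degree_le) (simp add: coeff)
  then have "poly_act M p v = (\<Sum>i\<le>?N. complex_of_real (c (?g i)) *s ?g i)"
    by (simp add: poly_act_altdef coeff)
  also have "\<dots> = (\<Sum>i\<le>?N. c (?g i) *\<^sub>R ?g i)"
    by (intro sum.cong refl) (simp add: vec_eq_iff complex_eq_iff)
  also have "\<dots> = 0" using c(1) unfolding sum.reindex[OF True] by (simp add: o_def)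
  finally have "poly_act M p v = 0" .
  moreover obtain i where "i \<le> ?N" "c (?g i) \<noteq> 0" using c(2) by auto
  then have "coeff p i \<noteq> 0" unfolding coeff by simp
  then have "p \<noteq> 0" by auto
  ultimately show ?thesis by blast
next
  case False
  then obtain i j where ij: "i \<noteq> j" "((*v) M ^^ i) v = ((*v) M ^^ j) v"
    by (auto simp: inj_on_def)
  let ?p = "monom 1 i - monom 1 j :: complex poly"
  have "degree ?p \<le> max i j" by (intro degree_diff_le) (simp_all add: degree_monom_eq)
  from poly_act_altdef[OF this, of M v] have "poly_act M ?p v =
      (\<Sum>k\<le>max i j. (if k = i then ((*v) M ^^ i) v else 0)
      - (if k = j then ((*v) M ^^ j) v else 0))"
    by (elim trans, intro sum.cong) auto
  also have "\<dots> = 0" using ij by (simp add: sum_subtractf)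
  finally have "poly_act M ?p v = 0" .
  moreover have "coeff ?p i \<noteq> 0" using ij by simp
  then have "?p \<noteq> 0" by force
  ultimately show ?thesis by blast
qed

text \<open>The coordinatewise embedding into complex vectors commutes with \<open>F\<close> and
  preserves norms, so the complex result transfers.\<close>

lemma summable_orbit_schur_stable:
  fixes F :: "real^'n^'n"
  assumes "schur_stable F"
  shows "summable (\<lambda>t. norm (((*v) F ^^ t) v))"
proof -
  let ?M = "map_matrix complex_of_real F" and ?c = "\<lambda>v :: real^'n. \<chi> i. complex_of_real (v $ i)"
  have "?M *v ?c u = ?c (F *v u)" for u
    by (simp add: vec_eq_iff matrix_vector_mult_def)
  then have "((*v) ?M ^^ t) (?c v) = ?c (((*v) F ^^ t) v)" for t
    by (induction t) simp_all
  moreover have "norm (?c u) = norm u" for u by (simp add: norm_vec_def)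
  moreover obtain p where "p \<noteq> 0" "poly_act ?M p (?c v) = 0"
    using ex_annihilating_poly by blast
  then have "summable (\<lambda>t. norm (((*v) ?M ^^ t) (?c v)))"
    using assms by (intro summable_orbit_of_annihilated[of ?M p]) (auto simp: schur_stable_def)
  ultimately show ?thesis by simp
qed

subsection \<open>Trajectories and the available storage\<close>

lemma trajectory_add:
  "trajectory F G (x + y) (\<lambda>t. u t + w t) t = trajectory F G x u t + trajectory F G y w t"
  by (induction t) (simp_all add: matrix_vector_right_distrib)

lemma trajectory_scaleR:
  "trajectory F G (c *\<^sub>R x) (\<lambda>t. c *\<^sub>R u t) t = c *\<^sub>R trajectory F G x u t"
  by (induction t) (simp_all add: matrix_vector_mult_scaleR scaleR_add_right)

lemma trajectory_Suc_shift:
  "trajectory F G x u (Suc t) = trajectory F G (F *v x + G *v u 0) (\<lambda>t. u (Suc t)) t"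
  by (induction t) simp_all

lemma trajectory_cong:
  "(\<And>s. s < t \<Longrightarrow> u s = w s) \<Longrightarrow> trajectory F G x u t = trajectory F G x w t"
  by (induction t) simp_all

section \<open>A norm adapted to a stable matrix, and the finite gain\<close>

definition orbit_norm :: "real^'n^'n \<Rightarrow> real^'n \<Rightarrow> real" where
  "orbit_norm F v = (\<Sum>t. norm (((*v) F ^^ t) v))"

lemma funpow_matrix_scaleR: "((*v) F ^^ t) (c *\<^sub>R v) = c *\<^sub>R ((*v) F ^^ t) v"
  for F :: "real^'n^'n"
  by (induction t) (simp_all add: matrix_vector_mult_scaleR)

context
  fixes F :: "real^'n^'n"
  assumes stable: "schur_stable F"
begin

lemmas orbit_summable = summable_orbit_schur_stable[OF stable]

lemma orbit_norm_nonneg: "0 \<le> orbit_norm F v"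
  unfolding orbit_norm_def by (intro suminf_nonneg orbit_summable) simp

text \<open>Applying \<open>F\<close> removes the first term of the series. Together with
  \<open>orbit_norm_bound\<close> this makes \<open>F\<close> a strict contraction for
  \<open>orbit_norm\<close>.\<close>

lemma orbit_norm_mult: "orbit_norm F (F *v v) = orbit_norm F v - norm v"
  unfolding orbit_norm_def using suminf_split_head[OF orbit_summable[of v]]
  by (simp add: funpow_swap1)

lemma norm_le_orbit_norm: "norm v \<le> orbit_norm F v"
  using orbit_norm_mult[of v] orbit_norm_nonneg[of "F *v v"] by linarith

lemma orbit_norm_triangle: "orbit_norm F (v + w) \<le> orbit_norm F v + orbit_norm F w"
  unfolding orbit_norm_def suminf_add[OF orbit_summable orbit_summable]
  by (intro suminf_le summable_add orbit_summable)
    (simp add: funpow_matrix_linear norm_triangle_ineq)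

lemma orbit_norm_scaleR: "orbit_norm F (c *\<^sub>R v) = \<bar>c\<bar> * orbit_norm F v"
  unfolding orbit_norm_def by (simp add: funpow_matrix_scaleR suminf_mult orbit_summable)

lemma orbit_norm_bound: obtains c where "c \<ge> 1" "\<And>v. orbit_norm F v \<le> c * norm v"
proof
  \<comment> \<open>The summand 1 ensures \<open>c \<ge> 1\<close>, so that the contraction factor
    \<open>1 - 1 / c\<close> used later is nonnegative.\<close>
  let ?c = "1 + (\<Sum>b\<in>Basis. orbit_norm F b)"
  show "?c \<ge> 1" by (simp add: sum_nonneg orbit_norm_nonneg)
  fix v :: "real^'n"
  have sum_le: "orbit_norm F (\<Sum>b\<in>S. f b) \<le> (\<Sum>b\<in>S. orbit_norm F (f b))"
    if "finite S" for S and f :: "real^'n \<Rightarrow> real^'n"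
    using that
  proof (induction S)
    case empty
    then show ?case using orbit_norm_scaleR[of 0 0] by simp
  next
    case (insert b S)
    then show ?case using orbit_norm_triangle[of "f b" "sum f S"] by simp
  qed
  have "orbit_norm F v = orbit_norm F (\<Sum>b\<in>Basis. (v \<bullet> b) *\<^sub>R b)"
    by (simp add: euclidean_representation)
  also have "\<dots> \<le> (\<Sum>b\<in>Basis. \<bar>v \<bullet> b\<bar> * orbit_norm F b)"
    using sum_le[of Basis "\<lambda>b. (v \<bullet> b) *\<^sub>R b"] by (simp add: orbit_norm_scaleR)
  also have "\<dots> \<le> (\<Sum>b\<in>Basis. norm v * orbit_norm F b)"
    by (intro sum_mono mult_right_mono orbit_norm_nonneg) (simp add: Basis_le_norm)
  also have "\<dots> \<le> ?c * norm v" by (simp add: sum_distrib_left[symmetric] algebra_simps)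
  finally show "orbit_norm F v \<le> ?c * norm v" .
qed

text \<open>In the adapted norm the state obeys a scalar recurrence with factor below 1. Squaring it
  by convexity and summing bounds the energy of the state by that of the input.\<close>

lemma finite_l2_gain:
  fixes G :: "real^'w^'n"
  obtains C where "\<And>w T. (\<Sum>t<T. (norm (trajectory F G 0 w t))\<^sup>2) \<le> C * (\<Sum>t<T. w t \<bullet> w t)"
proof -
  obtain c where c: "c \<ge> 1" "\<And>v. orbit_norm F v \<le> c * norm v"
    using orbit_norm_bound by blast
  obtain g where g: "\<And>u. norm (G *v u) \<le> norm u * g" "g > 0"
    using bounded_linear.pos_bounded[OF matrix_vector_mul_bounded_linear[of G]] by blast
  define \<rho> where "\<rho> = 1 - 1 / c"
  have \<rho>: "0 \<le> \<rho>" "\<rho> < 1" using c(1) by (auto simp: \<rho>_def)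
  let ?C = "(c * g)\<^sup>2 / (1 - \<rho>)"
  show ?thesis
  proof
    fix w :: "nat \<Rightarrow> real^'w" and T
    define a where "a t = orbit_norm F (trajectory F G 0 w t)" for t
    have a0: "a t \<ge> 0" for t by (simp add: a_def orbit_norm_nonneg)
    have step: "a (Suc t) \<le> \<rho> * a t + c * g * norm (w t)" for t
    proof -
      let ?x = "trajectory F G 0 w t"
      have "a (Suc t) \<le> orbit_norm F (F *v ?x) + orbit_norm F (G *v w t)"
        by (simp add: a_def orbit_norm_triangle)
      moreover have "orbit_norm F (F *v ?x) \<le> \<rho> * a t"
        using c(1) c(2)[of ?x] by (simp add: orbit_norm_mult a_def \<rho>_def field_simps)
      moreover have "orbit_norm F (G *v w t) \<le> c * (norm (w t) * g)"
        using c(1) by (intro order_trans[OF c(2)] mult_left_mono g) auto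
      ultimately show ?thesis by (simp add: ac_simps)
    qed
    have "(a (Suc t))\<^sup>2 \<le> \<rho> * (a t)\<^sup>2 + ?C * (w t \<bullet> w t)" for t
    proof -
      let ?b = "c * g * norm (w t)"
      have "(a (Suc t))\<^sup>2 \<le> (\<rho> * a t + ?b)\<^sup>2" using step a0 by (intro power_mono) auto
      also have "\<dots> \<le> \<rho> * (a t)\<^sup>2 + ?b\<^sup>2 / (1 - \<rho>)"
      proof -
        \<comment> \<open>Convexity of the square for weights \<open>\<rho>\<close> and
          \<open>1 - \<rho>\<close> at the points \<open>a t\<close> and
          \<open>?b / (1 - \<rho>)\<close>, written out as a perfect square.\<close>
        have "0 \<le> \<rho> * ((1 - \<rho>) * a t - ?b)\<^sup>2" using \<rho> by simp
        also have "\<dots> = \<rho> * (a t)\<^sup>2 * (1 - \<rho>) + ?b\<^sup>2 - (\<rho> * a t + ?b)\<^sup>2 * (1 - \<rho>)"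
          by (simp add: power2_eq_square algebra_simps)
        finally show ?thesis using \<rho> by (simp add: field_simps)
      qed
      finally show ?thesis by (simp add: power_mult_distrib dot_square_norm)
    qed
    then have "(1 - \<rho>) * (\<Sum>t<T. (a t)\<^sup>2) \<le> (a 0)\<^sup>2 + (\<Sum>t<T. ?C * (w t \<bullet> w t))"
      by (rule sum_recurrence_le) simp
    moreover have "a 0 = 0" using orbit_norm_scaleR[of 0 0] by (simp add: a_def)
    moreover have "(\<Sum>t<T. (norm (trajectory F G 0 w t))\<^sup>2) \<le> (\<Sum>t<T. (a t)\<^sup>2)"
      by (intro sum_mono power_mono) (simp_all add: a_def norm_le_orbit_norm)
    ultimately have "(1 - \<rho>) * (\<Sum>t<T. (norm (trajectory F G 0 w t))\<^sup>2) \<le> ?C * (\<Sum>t<T. w t \<bullet> w t)"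
      using \<rho> mult_left_mono[of "\<Sum>t<T. (norm (trajectory F G 0 w t))\<^sup>2" "\<Sum>t<T. (a t)\<^sup>2" "1 - \<rho>"]
      by (simp add: sum_distrib_left)
    then show "(\<Sum>t<T. (norm (trajectory F G 0 w t))\<^sup>2) \<le> ?C / (1 - \<rho>) * (\<Sum>t<T. w t \<bullet> w t)"
      using \<rho> by (simp add: pos_le_divide_eq mult.commute)
  qed
qed

end

section \<open>From the parallelogram law to a quadratic form\<close>

text \<open>The defect \<open>h r = f r - r f 1\<close> is additive and vanishes on integers, so it
  has period 1 and is bounded everywhere. A bounded additive function is zero.\<close>

lemma additive_bounded_imp_homogeneous:
  fixes f :: "real \<Rightarrow> real"
  assumes add: "\<And>r s. f (r + s) = f r + f s" and bound: "\<And>r. \<bar>r\<bar> \<le> 1 \<Longrightarrow> \<bar>f r\<bar> \<le> M"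
  shows "f r = r * f 1"
proof -
  define h where "h r = f r - r * f 1" for r
  have h_add: "h (r + s) = h r + h s" for r s by (simp add: h_def add algebra_simps)
  have h0: "h 0 = 0" using h_add[of 0 0] by simp
  have h_minus: "h (- r) = - h r" for r using h_add[of r "- r"] h0 by simp
  have h_nat: "h (real n * r) = real n * h r" for n r
    by (induction n) (simp_all add: h0 h_add algebra_simps)
  have "h (real n) = 0" for n using h_nat[of n 1] by (simp add: h_def)
  then have h_int: "h (of_int m) = 0" for m
    using h_minus by (cases m rule: int_cases2) auto
  have h_bound: "\<bar>h r\<bar> \<le> M + \<bar>f 1\<bar>" for r
  proof -
    have "h r = h (frac r)"
      using h_add[of "frac r" "of_int \<lfloor>r\<rfloor>"] h_int by (simp add: frac_def)
    moreover have "\<bar>frac r\<bar> \<le> 1" using frac_ge_0[of r] frac_lt_1[of r] by linarith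
    then have "\<bar>f (frac r)\<bar> \<le> M" "\<bar>frac r * f 1\<bar> \<le> \<bar>f 1\<bar>"
      by (auto intro: bound simp: abs_mult mult_left_le_one_le)
    ultimately show ?thesis unfolding h_def by linarith
  qed
  have "h r = 0"
  proof (rule ccontr)
    assume "h r \<noteq> 0"
    then obtain n where "M + \<bar>f 1\<bar> < real n * \<bar>h r\<bar>"
      using reals_Archimedean3 by (metis zero_less_abs_iff)
    then show False using h_bound[of "real n * r"] by (simp add: h_nat abs_mult)
  qed
  then show ?thesis by (simp add: h_def)
qed

text \<open>Jordan and von Neumann's argument, with boundedness replacing the continuity of a norm.\<close>

lemma parallelogram_law_imp_quadratic_form:
  fixes V :: "real^'n \<Rightarrow> real"
  assumes par: "\<And>x y. V (x + y) + V (x - y) = 2 * V x + 2 * V y"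
    and bound: "\<And>x. 0 \<le> V x" "\<And>x. V x \<le> c * (norm x)\<^sup>2"
  obtains P where "symmetric_mat P" "\<And>x. V x = x \<bullet> (P *v x)"
proof -
  define b where "b x y = (V (x + y) - V (x - y)) / 4" for x y
  have V0: "V 0 = 0" using par[of 0 0] by simp
  have V_minus: "V (- x) = V x" for x using par[of 0 x] V0 by simp
  have b_sym: "b x y = b y x" for x y
    using V_minus[of "x - y"] by (simp add: b_def add.commute)
  have b0: "b 0 y = 0" for y by (simp add: b_def V_minus)
  \<comment> \<open>The parallelogram law with increment \<open>z\<close> is used at
    \<open>x + y\<close> and at \<open>x - y\<close>; the terms in \<open>V z\<close> cancel in the
    difference.\<close>
  have b_par: "b (x + z) y + b (x - z) y = 2 * b x y" for x y z
  proof -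
    have arith: "(p1 - p2) / 4 + (p3 - p4) / 4 = 2 * ((p5 - p6) / 4)"
      if "p1 + p3 = 2 * p5 + 2 * p7" "p2 + p4 = 2 * p6 + 2 * p7" for p1 p2 p3 p4 p5 p6 p7 :: real
      using that by (simp add: field_simps)
    have "x + z + y = x + y + z" "x + z - y = x - y + z" "x - z + y = x + y - z" "x - z - y = x - y - z"
      by simp_all
    then show ?thesis
      using arith[OF par[of "x + y" z] par[of "x - y" z]] unfolding b_def by (simp only:)
  qed
  have b_double: "b (2 *\<^sub>R x) y = 2 * b x y" for x y
    using b_par[of x x y] by (simp add: b0 scaleR_2)
  have b_add: "b (p + q) y = b p y + b q y" for p q y
  proof -
    have "(1/2) *\<^sub>R (p + q) + (1/2) *\<^sub>R (p - q) = p" "(1/2) *\<^sub>R (p + q) - (1/2) *\<^sub>R (p - q) = q"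
      by (simp_all add: vec_eq_iff field_simps)
    then show ?thesis
      using b_par[of "(1/2) *\<^sub>R (p + q)" "(1/2) *\<^sub>R (p - q)" y] b_double[of "(1/2) *\<^sub>R (p + q)" y]
      by simp
  qed
  have c: "c * (norm z)\<^sup>2 \<le> \<bar>c\<bar> * k\<^sup>2" if "norm z \<le> k" for k and z :: "real^'n"
    using that by (intro mult_mono power_mono) auto
  \<comment> \<open>Boundedness on a unit interval of scalars is what turns additivity into
    homogeneity.\<close>
  have b_bound: "\<bar>b (r *\<^sub>R x) y\<bar> \<le> \<bar>c\<bar> * (norm x + norm y)\<^sup>2" if "\<bar>r\<bar> \<le> 1" for r x y
  proof -
    have "norm (r *\<^sub>R x) \<le> norm x" using that by (simp add: mult_left_le_one_le)
    then have "norm (r *\<^sub>R x + y) \<le> norm x + norm y" "norm (r *\<^sub>R x - y) \<le> norm x + norm y"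
      using norm_triangle_ineq[of "r *\<^sub>R x" y] norm_triangle_ineq4[of "r *\<^sub>R x" y] by linarith+
    then have "V (r *\<^sub>R x + y) \<le> \<bar>c\<bar> * (norm x + norm y)\<^sup>2" "V (r *\<^sub>R x - y) \<le> \<bar>c\<bar> * (norm x + norm y)\<^sup>2"
      using bound(2) c by (meson order_trans)+
    moreover have "\<bar>(s - t) / 4\<bar> \<le> m" if "s \<le> m" "t \<le> m" "0 \<le> s" "0 \<le> t" for s t m :: real
      using that by (intro abs_leI) (simp_all add: field_simps)
    ultimately show ?thesis unfolding b_def using bound(1) by blast
  qed
  have b_scale: "b (r *\<^sub>R x) y = r * b x y" for r x y
    using additive_bounded_imp_homogeneous[of "\<lambda>r. b (r *\<^sub>R x) y", OF _ b_bound]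
    by (simp add: scaleR_add_left b_add)
  have linear_left: "linear (\<lambda>x. b x y)" for y by (rule linearI) (simp_all add: b_add b_scale)
  define P where "P = matrix (\<lambda>y. \<chi> i. b (axis i 1) y)"
  have "linear (\<lambda>y. \<chi> i. b (axis i 1) y)"
    by (rule linearI) (simp_all add: vec_eq_iff b_sym[of "axis _ _"] b_add b_scale)
  then have P: "P *v y = (\<chi> i. b (axis i 1) y)" for y
    unfolding P_def by (simp add: matrix_vector_mul)
  have form: "b x y = x \<bullet> (P *v y)" for x y
  proof -
    have "b x y = b (\<Sum>i\<in>UNIV. x $ i *\<^sub>R axis i 1) y"
      using basis_expansion[of x] by (simp add: scalar_mult_eq_scaleR)
    also have "\<dots> = (\<Sum>i\<in>UNIV. x $ i * b (axis i 1) y)"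
      by (simp add: linear_sum[OF linear_left] b_scale)
    finally show ?thesis by (simp add: P inner_vec_def)
  qed
  show ?thesis
  proof
    show "symmetric_mat P"
      by (simp add: symmetric_mat_def P_def matrix_def transpose_def vec_eq_iff b_sym)
    show "V x = x \<bullet> (P *v x)" for x
      using par[of x x] by (simp add: form[symmetric] b_def V0)
  qed
qed

lemma quadratic_form_upper_bound:
  fixes S :: "real^'n^'n"
  obtains c where "c \<ge> 0" "\<And>x. x \<bullet> (S *v x) \<le> c * (norm x)\<^sup>2"
proof -
  obtain k where k: "\<And>x. norm (S *v x) \<le> norm x * k" "k > 0"
    using bounded_linear.pos_bounded[OF matrix_vector_mul_bounded_linear[of S]] by blast
  have "x \<bullet> (S *v x) \<le> k * (norm x)\<^sup>2" for x
    using norm_cauchy_schwarz[of x "S *v x"] mult_left_mono[OF k(1)[of x], of "norm x"]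
    by (simp add: power2_eq_square ac_simps)
  then show ?thesis using k(2) that[of k] by auto
qed

section \<open>The available storage of a system with gain at most \<open>\<gamma>\<close>\<close>

locale l2_gain =
  fixes F :: "real^'n^'n" and G :: "real^'w^'n" and S :: "real^'n^'n" and \<gamma> :: real
  assumes S: "pos_def S" and G: "pos_def (G ** transpose G)"
    and gain: "\<And>w T. (\<Sum>t<T. trajectory F G 0 w t \<bullet> (S *v trajectory F G 0 w t))
      \<le> \<gamma>\<^sup>2 * (\<Sum>t<T. w t \<bullet> w t)"
begin

definition cost :: "nat \<Rightarrow> real^'n \<Rightarrow> (nat \<Rightarrow> real^'w) \<Rightarrow> real" where
  "cost T x w = (\<Sum>t<T. trajectory F G x w t \<bullet> (S *v trajectory F G x w t) - \<gamma>\<^sup>2 * (w t \<bullet> w t))"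

text \<open>The horizon is part of the supremum, so every cost is a finite sum and convergence is
  never an issue.\<close>

definition V :: "real^'n \<Rightarrow> real" where
  "V x = (SUP (T, w). cost T x w)"

lemma S_nonneg: "0 \<le> x \<bullet> (S *v x)"
  using pos_def_imp_semidef[OF S] by (simp add: pos_semidef_def)

lemma cost_Suc:
  "cost (Suc T) x w = x \<bullet> (S *v x) - \<gamma>\<^sup>2 * (w 0 \<bullet> w 0) + cost T (F *v x + G *v w 0) (\<lambda>t. w (Suc t))"
  unfolding cost_def
  by (subst sum.lessThan_Suc_shift) (simp del: trajectory.simps(2) add: trajectory_Suc_shift)

text \<open>Once the disturbance is switched off, each further stage adds
  \<open>x \<bullet> (S *v x) \<ge> 0\<close>. This brings two inputs to a common horizon.\<close>

lemma cost_extend: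
  assumes "T \<le> T'"
  shows "cost T x w \<le> cost T' x (\<lambda>t. if t < T then w t else 0)"
proof -
  let ?w = "\<lambda>t. if t < T then w t else 0"
  have "cost T x w = cost T x ?w"
    unfolding cost_def
  proof (intro sum.cong refl)
    fix t assume "t \<in> {..<T}"
    then have "trajectory F G x w t = trajectory F G x ?w t" by (intro trajectory_cong) auto
    with \<open>t \<in> {..<T}\<close> show "trajectory F G x w t \<bullet> (S *v trajectory F G x w t) - \<gamma>\<^sup>2 * (w t \<bullet> w t)
      = trajectory F G x ?w t \<bullet> (S *v trajectory F G x ?w t) - \<gamma>\<^sup>2 * (?w t \<bullet> ?w t)" by simp
  qed
  also have "\<dots> \<le> cost T' x ?w"
    unfolding cost_def using assms by (intro sum_mono2) (auto simp: S_nonneg)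
  finally show ?thesis .
qed

text \<open>Since \<open>G ** transpose G\<close> is invertible, every state is reached from the origin in one
  step, so the gain inequality bounds the cost from an arbitrary initial state.\<close>

lemma cost_upper_bound: obtains c where "\<And>T x w. cost T x w \<le> c * (norm x)\<^sup>2"
proof -
  let ?W = "G ** transpose G"
  have inv: "invertible ?W" using G by (rule pos_def_invertible)
  \<comment> \<open>A right inverse of \<open>G\<close>: the input \<open>?N *v x\<close> steers the
    origin to \<open>x\<close> in one step, at an energy quadratic in \<open>norm x\<close>.\<close>
  let ?N = "transpose G ** matrix_inv ?W"
  obtain k where k: "\<And>x. norm (?N *v x) \<le> norm x * k" "k > 0"
    using bounded_linear.pos_bounded[OF matrix_vector_mul_bounded_linear[of ?N]] by blast
  have "cost T x w \<le> (\<gamma>\<^sup>2 * k\<^sup>2) * (norm x)\<^sup>2" for T x w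
  proof -
    define u where "u = case_nat (?N *v x) w"
    have "G *v (?N *v x) = x"
      by (simp add: matrix_vector_mul_assoc matrix_mul_assoc matrix_inv_right[OF inv])
    then have "cost (Suc T) 0 u = - \<gamma>\<^sup>2 * ((?N *v x) \<bullet> (?N *v x)) + cost T x w"
      by (simp add: cost_Suc u_def)
    moreover have "cost (Suc T) 0 u \<le> 0"
      using gain[where w=u and T="Suc T"] unfolding cost_def
      by (simp only: sum_subtractf sum_distrib_left)
    moreover have "(?N *v x) \<bullet> (?N *v x) \<le> k\<^sup>2 * (norm x)\<^sup>2"
      using power_mono[OF k(1)[of x], of 2] by (simp add: dot_square_norm power_mult_distrib ac_simps)
    then have "\<gamma>\<^sup>2 * ((?N *v x) \<bullet> (?N *v x)) \<le> \<gamma>\<^sup>2 * (k\<^sup>2 * (norm x)\<^sup>2)"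
      by (intro mult_left_mono) auto
    ultimately show ?thesis by (simp add: ac_simps)
  qed
  then show ?thesis using that by blast
qed

lemma bdd_above_cost: "bdd_above (range (\<lambda>(T, w). cost T x w))"
proof -
  obtain c where "\<And>T x w. cost T x w \<le> c * (norm x)\<^sup>2" using cost_upper_bound by blast
  then show ?thesis by (intro bdd_aboveI[of _ "c * (norm x)\<^sup>2"]) auto
qed

lemma cost_le_V: "cost T x w \<le> V x"
  unfolding V_def using cSUP_upper[OF UNIV_I[of "(T, w)"] bdd_above_cost[of x]] by simp

lemma V_leI: "(\<And>T w. cost T x w \<le> M) \<Longrightarrow> V x \<le> M"
  unfolding V_def by (intro cSUP_least) auto

lemma V_ge_stage: "x \<bullet> (S *v x) \<le> V x"
  using cost_le_V[of "Suc 0" x "\<lambda>_. 0"] by (simp add: cost_def)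

lemma cost_parallelogram:
  "cost T (x + y) (\<lambda>t. u t + w t) + cost T (x - y) (\<lambda>t. u t - w t) = 2 * cost T x u + 2 * cost T y w"
proof -
  have minus: "trajectory F G (x - y) (\<lambda>t. u t - w t) t = trajectory F G x u t - trajectory F G y w t" for t
    using trajectory_add[of F G x "(-1) *\<^sub>R y" u "\<lambda>t. (-1) *\<^sub>R w t" t] trajectory_scaleR[of F G "-1" y w t]
    by simp
  show ?thesis
    unfolding cost_def trajectory_add minus
    by (simp add: sum.distrib[symmetric] sum_distrib_left algebra_simps inner_add_left inner_add_right
        inner_diff_left inner_diff_right matrix_vector_right_distrib)
qed

text \<open>Inputs \<open>u\<close> for \<open>x\<close> and \<open>w\<close> for \<open>y\<close>,
  extended to a common horizon, combine to \<open>u + w\<close> for \<open>x + y\<close> and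
  \<open>u - w\<close> for \<open>x - y\<close>. The suprema over the two inputs are then taken one
  after the other.\<close>

lemma V_parallelogram_ge: "2 * V x + 2 * V y \<le> V (x + y) + V (x - y)"
proof -
  have *: "2 * cost T1 x u + 2 * cost T2 y w \<le> V (x + y) + V (x - y)" for T1 T2 u w
  proof -
    let ?T = "max T1 T2" and ?u = "\<lambda>t. if t < T1 then u t else 0"
      and ?w = "\<lambda>t. if t < T2 then w t else 0"
    have "2 * cost T1 x u + 2 * cost T2 y w \<le> 2 * cost ?T x ?u + 2 * cost ?T y ?w"
      by (intro add_mono mult_left_mono cost_extend) auto
    also have "\<dots> \<le> V (x + y) + V (x - y)"
      unfolding cost_parallelogram[symmetric] by (intro add_mono cost_le_V)
    finally show ?thesis .
  qed
  have "V x \<le> (V (x + y) + V (x - y) - 2 * cost T2 y w) / 2" for T2 w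
    by (rule V_leI) (use * in \<open>simp add: field_simps\<close>)
  then have "V y \<le> (V (x + y) + V (x - y) - 2 * V x) / 2"
    by (intro V_leI) (simp add: field_simps)
  then show ?thesis by simp
qed

lemma V_double: "V (2 *\<^sub>R x) = 4 * V x"
proof -
  have ge: "c\<^sup>2 * V x \<le> V (c *\<^sub>R x)" if "c \<noteq> 0" for c x
  proof -
    have "c\<^sup>2 * cost T x w \<le> V (c *\<^sub>R x)" for T w
    proof -
      have "cost T (c *\<^sub>R x) (\<lambda>t. c *\<^sub>R w t) = c\<^sup>2 * cost T x w"
        unfolding cost_def trajectory_scaleR sum_distrib_left
        by (simp add: matrix_vector_mult_scaleR power2_eq_square algebra_simps)
      then show ?thesis using cost_le_V by metis
    qed
    then have "V x \<le> V (c *\<^sub>R x) / c\<^sup>2" using that by (intro V_leI) (simp add: field_simps)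
    then show ?thesis using that by (simp add: field_simps)
  qed
  \<comment> \<open>Scaling by 2 and back by 1/2 gives the two inequalities.\<close>
  show ?thesis using ge[of 2 x] ge[of "1/2" "2 *\<^sub>R x"] by (simp add: power2_eq_square)
qed

text \<open>The reverse inequality is the proved one at \<open>x + y\<close> and
  \<open>x - y\<close>, whose sum and difference are \<open>2 x\<close> and
  \<open>2 y\<close>.\<close>

lemma V_parallelogram: "V (x + y) + V (x - y) = 2 * V x + 2 * V y"
  using V_parallelogram_ge[of x y] V_parallelogram_ge[of "x + y" "x - y"] V_double[of x] V_double[of y]
  by (simp add: scaleR_2)

text \<open>Prepending \<open>u\<close> to any input for the successor state gives an input for
  \<open>x\<close> with one more stage.\<close>

lemma V_dissipation: "V (F *v x + G *v u) + x \<bullet> (S *v x) - \<gamma>\<^sup>2 * (u \<bullet> u) \<le> V x"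
proof -
  have "V (F *v x + G *v u) \<le> V x - x \<bullet> (S *v x) + \<gamma>\<^sup>2 * (u \<bullet> u)"
  proof (rule V_leI)
    fix T w
    show "cost T (F *v x + G *v u) w \<le> V x - x \<bullet> (S *v x) + \<gamma>\<^sup>2 * (u \<bullet> u)"
      using cost_le_V[of "Suc T" x "case_nat u w"] by (simp add: cost_Suc)
  qed
  then show ?thesis by simp
qed

lemma ex_storage_matrix:
  obtains P where "pos_def P"
    "\<And>x u. (F *v x + G *v u) \<bullet> (P *v (F *v x + G *v u)) - x \<bullet> (P *v x) + x \<bullet> (S *v x) - \<gamma>\<^sup>2 * (u \<bullet> u) \<le> 0"
proof -
  obtain c where "\<And>T x w. cost T x w \<le> c * (norm x)\<^sup>2" using cost_upper_bound by blast
  then have "V x \<le> c * (norm x)\<^sup>2" for x by (intro V_leI)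
  moreover have "0 \<le> V x" for x using V_ge_stage[of x] S_nonneg[of x] by linarith
  ultimately obtain P where P: "symmetric_mat P" "\<And>x. V x = x \<bullet> (P *v x)"
    using parallelogram_law_imp_quadratic_form[of V, OF V_parallelogram] by blast
  have "pos_def P"
    using P S V_ge_stage unfolding pos_def_def by (metis less_le_trans)
  moreover have "(F *v x + G *v u) \<bullet> (P *v (F *v x + G *v u)) - x \<bullet> (P *v x) + x \<bullet> (S *v x)
      - \<gamma>\<^sup>2 * (u \<bullet> u) \<le> 0" for x u
    using V_dissipation[of x u] by (simp add: P(2))
  ultimately show ?thesis using that by blast
qed

end

section \<open>Lyapunov stability and the epigraph\<close>

text \<open>For an eigenvector \<open>v = p + i q\<close>, the values of the real form at
  \<open>p\<close> and \<open>q\<close> add up to the Hermitian form at \<open>v\<close>. Hence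
  \<open>F\<close> multiplies this sum by \<open>(cmod c)\<^sup>2\<close>, while the hypothesis
  makes it strictly smaller.\<close>

lemma schur_stable_of_lyapunov:
  fixes F :: "real^'n^'n"
  assumes P: "pos_def P" and S: "pos_def S"
    and lyap: "\<And>x. (F *v x) \<bullet> (P *v (F *v x)) - x \<bullet> (P *v x) + x \<bullet> (S *v x) \<le> 0"
  shows "schur_stable F"
  unfolding schur_stable_def
proof (intro allI impI, elim conjE)
  fix c :: complex and v :: "complex^'n"
  assume v: "v \<noteq> 0" and eig: "map_matrix complex_of_real F *v v = c *s v"
  define p where "p = (\<chi> i. Re (v $ i))"
  define q where "q = (\<chi> i. Im (v $ i))"
  have pq: "p \<noteq> 0 \<or> q \<noteq> 0" using v by (auto simp: p_def q_def vec_eq_iff complex_eq_iff)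
  have eig_i: "(\<Sum>j\<in>UNIV. complex_of_real (F $ i $ j) * v $ j) = c * v $ i" for i
    using eig by (simp add: vec_eq_iff matrix_vector_mult_def)
  have Fp: "F *v p = Re c *\<^sub>R p - Im c *\<^sub>R q"
    using arg_cong[OF eig_i, of Re] by (simp add: vec_eq_iff matrix_vector_mult_def p_def q_def)
  have Fq: "F *v q = Re c *\<^sub>R q + Im c *\<^sub>R p"
    using arg_cong[OF eig_i, of Im] by (simp add: vec_eq_iff matrix_vector_mult_def p_def q_def)
  have sym: "q \<bullet> (P *v p) = p \<bullet> (P *v q)" using P symmetric_mat_inner pos_def_def by blast
  let ?P = "p \<bullet> (P *v p) + q \<bullet> (P *v q)"
  have pos: "M \<in> {P, S} \<Longrightarrow> 0 < p \<bullet> (M *v p) + q \<bullet> (M *v q)" for M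
  proof -
    assume "M \<in> {P, S}"
    then have M: "x \<noteq> 0 \<Longrightarrow> 0 < x \<bullet> (M *v x)" "0 \<le> x \<bullet> (M *v x)" for x
      using P S pos_def_imp_semidef by (auto simp: pos_def_def pos_semidef_def)
    show ?thesis using pq M(1)[of p] M(1)[of q] M(2)[of p] M(2)[of q] by linarith
  qed
  have "(F *v p) \<bullet> (P *v (F *v p)) + (F *v q) \<bullet> (P *v (F *v q)) = (cmod c)\<^sup>2 * ?P"
    unfolding Fp Fq cmod_power2
    by (simp add: matrix_vector_right_distrib matrix_vector_mult_diff_distrib matrix_vector_mult_scaleR
        inner_add_left inner_add_right inner_diff_left inner_diff_right sym power2_eq_square algebra_simps)
  then have "(cmod c)\<^sup>2 * ?P < ?P"
    using lyap[of p] lyap[of q] pos[of S] by auto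
  then have "(cmod c)\<^sup>2 < 1" using pos[of P] by simp
  then show "cmod c < 1" by (simp add: power_less_one_iff abs_square_less_1)
qed

lemma pos_def_cost:
  fixes Q :: "real^'x^'x" and K :: "real^'x^'u"
  assumes "pos_def Q" "pos_def R"
  shows "pos_def (Q + transpose K ** R ** K)"
  unfolding pos_def_def
proof (intro conjI allI impI)
  show "symmetric_mat (Q + transpose K ** R ** K)"
    using assms by (simp add: pos_def_def symmetric_mat_def block_simps matrix_mul_assoc)
  fix v :: "real^'x" assume "v \<noteq> 0"
  then have "0 < v \<bullet> (Q *v v)" "0 \<le> (K *v v) \<bullet> (R *v (K *v v))"
    using assms pos_def_imp_semidef[OF assms(2)] by (auto simp: pos_def_def pos_semidef_def)
  then show "0 < v \<bullet> ((Q + transpose K ** R ** K) *v v)"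
    by (simp add: matrix_vector_mult_add_rdistrib inner_add_right matrix_vector_mul_assoc[symmetric]
        inner_transpose_mult del: transpose_matrix_vector)
qed

lemma zero_in_l2_unit_ball: "(\<lambda>_. 0) \<in> l2_unit_ball"
  by (simp add: l2_unit_ball_def)

lemma trajectory_zero: "trajectory F G 0 (\<lambda>_. 0) t = 0"
  by (induction t) simp_all

lemma sum_le_one_of_l2_unit_ball: "w \<in> l2_unit_ball \<Longrightarrow> (\<Sum>t<T. w t \<bullet> w t) \<le> 1"
  unfolding l2_unit_ball_def using sum_le_suminf[of "\<lambda>t. w t \<bullet> w t" "{..<T}"] by fastforce

text \<open>Both sides are quadratic in \<open>w\<close>, so \<open>w\<close> may be cut off at
  \<open>T\<close> and scaled to unit energy. With zero energy the state stays at the origin before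
  time \<open>T\<close>.\<close>

lemma finite_horizon_gain_of_unit_ball:
  fixes F :: "real^'n^'n" and G :: "real^'w^'n"
  assumes S: "pos_def S"
    and ball: "\<And>w T. w \<in> l2_unit_ball \<Longrightarrow>
      (\<Sum>t<T. trajectory F G 0 w t \<bullet> (S *v trajectory F G 0 w t)) \<le> \<beta>"
  shows "(\<Sum>t<T. trajectory F G 0 w t \<bullet> (S *v trajectory F G 0 w t)) \<le> \<beta> * (\<Sum>t<T. w t \<bullet> w t)"
proof -
  define s where "s = (\<Sum>t<T. w t \<bullet> w t)"
  let ?q = "\<lambda>w t. trajectory F G 0 w t \<bullet> (S *v trajectory F G 0 w t)"
  show ?thesis
  proof (cases "s = 0")
    case True
    then have "\<forall>t\<in>{..<T}. w t \<bullet> w t = 0"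
      unfolding s_def by (subst (asm) sum_nonneg_eq_0_iff) auto
    then have "trajectory F G 0 w t = 0" if "t < T" for t
      using that trajectory_cong[of t w "\<lambda>_. 0" F G 0] by (simp add: trajectory_zero)
    then show ?thesis using True by (simp add: s_def)
  next
    case False
    then have s: "s > 0" unfolding s_def by (simp add: less_le sum_nonneg)
    define u where "u t = (if t < T then (1 / sqrt s) *\<^sub>R w t else 0)" for t
    have "(\<lambda>t. u t \<bullet> u t) sums (\<Sum>t<T. u t \<bullet> u t)"
      by (rule sums_finite) (auto simp: u_def)
    moreover have "(\<Sum>t<T. u t \<bullet> u t) = (\<Sum>t<T. (1 / s) * (w t \<bullet> w t))"
      using s by (intro sum.cong) (auto simp: u_def)
    then have "(\<Sum>t<T. u t \<bullet> u t) = 1" using s by (simp add: sum_divide_distrib[symmetric] s_def)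
    ultimately have "u \<in> l2_unit_ball"
      by (simp add: l2_unit_ball_def sums_iff)
    then have "(\<Sum>t<T. ?q u t) \<le> \<beta>" by (rule ball)
    moreover have "(\<Sum>t<T. ?q u t) = (\<Sum>t<T. (1 / s) * ?q w t)"
    proof (intro sum.cong refl)
      fix t assume "t \<in> {..<T}"
      then have "trajectory F G 0 u t = trajectory F G 0 (\<lambda>t. (1 / sqrt s) *\<^sub>R w t) t"
        by (intro trajectory_cong) (auto simp: u_def)
      then have "trajectory F G 0 u t = (1 / sqrt s) *\<^sub>R trajectory F G 0 w t"
        using trajectory_scaleR[of F G "1 / sqrt s" 0 w t] by simp
      then show "?q u t = (1 / s) * ?q w t"
        using s by (simp add: matrix_vector_mult_scaleR)
    qed
    ultimately have "(1 / s) * (\<Sum>t<T. ?q w t) \<le> \<beta>" by (simp add: sum_distrib_left)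
    then show ?thesis using s by (simp add: s_def[symmetric] field_simps)
  qed
qed

lemma epi_J_inf_iff:
  fixes A :: "real^'x^'x" and B :: "real^'u^'x" and Bw :: "real^'w^'x"
  assumes Q: "pos_def Q" and R: "pos_def R" and W: "pos_def (Bw ** transpose Bw)" and \<gamma>: "\<gamma> > 0"
  shows "(K, \<gamma>) \<in> epi_J_inf A B Bw Q R \<longleftrightarrow> (\<exists>P. pos_def P \<and> (K, \<gamma>, P) \<in> L_lft A B Bw Q R)"
proof -
  define F where "F = A + B ** K"
  define S where "S = Q + transpose K ** R ** K"
  define q where "q w t = trajectory F Bw 0 w t \<bullet> (S *v trajectory F Bw 0 w t)" for w t
  have S: "pos_def S" unfolding S_def using Q R by (rule pos_def_cost)
  have q_nonneg: "0 \<le> q w t" for w t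
    using pos_def_imp_semidef[OF S] by (simp add: q_def pos_semidef_def)
  have J: "J_inf A B Bw Q R K = sqrt (SUP w\<in>l2_unit_ball. \<Sum>t. q w t)"
    by (simp add: J_inf_def q_def F_def S_def)
  have L: "(K, \<gamma>, P) \<in> L_lft A B Bw Q R \<longleftrightarrow>
      (\<forall>x u. (F *v x + Bw *v u) \<bullet> (P *v (F *v x + Bw *v u)) - x \<bullet> (P *v x) + x \<bullet> (S *v x)
        - \<gamma>\<^sup>2 * (u \<bullet> u) \<le> 0)" if "pos_def P" for P
    using Q R \<gamma> that by (simp add: L_lft_def loewner_le_0_M_lft_iff pos_def_def M_lft_form F_def S_def)
  show ?thesis
  proof
    assume "\<exists>P. pos_def P \<and> (K, \<gamma>, P) \<in> L_lft A B Bw Q R"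
    then obtain P where P: "pos_def P" and lmi: "\<And>x u. (F *v x + Bw *v u) \<bullet> (P *v (F *v x + Bw *v u))
        - x \<bullet> (P *v x) + x \<bullet> (S *v x) - \<gamma>\<^sup>2 * (u \<bullet> u) \<le> 0" using L by blast
    \<comment> \<open>With zero disturbance the inequality becomes the Lyapunov inequality.\<close>
    have "schur_stable F"
      using schur_stable_of_lyapunov[OF P S] lmi[of _ 0] by simp
    moreover have "(\<Sum>t. q w t) \<le> \<gamma>\<^sup>2" if w: "w \<in> l2_unit_ball" for w
    proof -
      let ?x = "trajectory F Bw 0 w"
      \<comment> \<open>The dissipation inequality summed from the zero state, whose storage is
        0.\<close>
      have "?x T \<bullet> (P *v ?x T) + (\<Sum>t<T. q w t) \<le> \<gamma>\<^sup>2 * (\<Sum>t<T. w t \<bullet> w t)" for T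
      proof (induction T)
        case (Suc T)
        then show ?case using lmi[of "?x T" "w T"] by (simp add: q_def distrib_left)
      qed simp
      moreover have "0 \<le> x \<bullet> (P *v x)" for x
        using pos_def_imp_semidef[OF P] by (simp add: pos_semidef_def)
      moreover have "\<gamma>\<^sup>2 * (\<Sum>t<T. w t \<bullet> w t) \<le> \<gamma>\<^sup>2" for T
        using mult_left_mono[OF sum_le_one_of_l2_unit_ball[OF w, of T], of "\<gamma>\<^sup>2"] by simp
      ultimately have bound: "(\<Sum>t<T. q w t) \<le> \<gamma>\<^sup>2" for T
        by (smt (verit, best))
      then have "summable (q w)" by (intro summableI_nonneg_bounded q_nonneg)
      then show ?thesis using bound by (intro suminf_le_const)
    qed
    then have "(SUP w\<in>l2_unit_ball. \<Sum>t. q w t) \<le> \<gamma>\<^sup>2"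
      using zero_in_l2_unit_ball by (intro cSUP_least) auto
    then have "J_inf A B Bw Q R K \<le> \<gamma>"
      unfolding J using \<gamma> real_sqrt_le_mono by fastforce
    ultimately show "(K, \<gamma>) \<in> epi_J_inf A B Bw Q R"
      by (simp add: epi_J_inf_def stabilizing_def F_def)
  next
    assume "(K, \<gamma>) \<in> epi_J_inf A B Bw Q R"
    then have stable: "schur_stable F" and J_le: "J_inf A B Bw Q R K \<le> \<gamma>"
      by (simp_all add: epi_J_inf_def stabilizing_def F_def)
    \<comment> \<open>Series and supremum carry information only if they converge and are bounded;
      stability supplies both through the finite gain.\<close>
    obtain C where C: "\<And>w T. (\<Sum>t<T. (norm (trajectory F Bw 0 w t))\<^sup>2) \<le> C * (\<Sum>t<T. w t \<bullet> w t)"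
      using finite_l2_gain[OF stable] by blast
    obtain c where c: "c \<ge> 0" "\<And>x. x \<bullet> (S *v x) \<le> c * (norm x)\<^sup>2"
      using quadratic_form_upper_bound by blast
    have bound: "(\<Sum>t<T. q w t) \<le> c * \<bar>C\<bar>" if w: "w \<in> l2_unit_ball" for w T
    proof -
      have "(\<Sum>t<T. q w t) \<le> c * (\<Sum>t<T. (norm (trajectory F Bw 0 w t))\<^sup>2)"
        unfolding q_def sum_distrib_left by (intro sum_mono c)
      also have "\<dots> \<le> c * (\<bar>C\<bar> * 1)"
      proof (intro mult_left_mono c)
        have "(\<Sum>t<T. (norm (trajectory F Bw 0 w t))\<^sup>2) \<le> C * (\<Sum>t<T. w t \<bullet> w t)" by (rule C)
        also have "\<dots> \<le> \<bar>C\<bar> * 1"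
          by (intro mult_mono sum_le_one_of_l2_unit_ball w) (auto intro: sum_nonneg)
        finally show "(\<Sum>t<T. (norm (trajectory F Bw 0 w t))\<^sup>2) \<le> \<bar>C\<bar> * 1" .
      qed
      finally show ?thesis by simp
    qed
    have summable: "summable (q w)" if "w \<in> l2_unit_ball" for w
      using bound[OF that] by (intro summableI_nonneg_bounded q_nonneg)
    have bdd: "bdd_above ((\<lambda>w. \<Sum>t. q w t) ` l2_unit_ball)"
      using bound by (intro bdd_aboveI2[of _ _ "c * \<bar>C\<bar>"] suminf_le_const summable)
    let ?J = "SUP w\<in>l2_unit_ball. \<Sum>t. q w t"
    \<comment> \<open>Nonnegativity of the supremum permits squaring
      \<open>sqrt ?J \<le> \<gamma>\<close>.\<close>
    have "0 \<le> (\<Sum>t. q (\<lambda>_. 0) t)" by (intro suminf_nonneg summable zero_in_l2_unit_ball q_nonneg)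
    also have "\<dots> \<le> ?J" by (rule cSUP_upper[OF zero_in_l2_unit_ball bdd])
    finally have J_nonneg: "0 \<le> ?J" .
    then have "?J = (sqrt ?J)\<^sup>2" by simp
    also have "\<dots> \<le> \<gamma>\<^sup>2" using J_le J_nonneg unfolding J by (intro power_mono) auto
    finally have "?J \<le> \<gamma>\<^sup>2" .
    then have "(\<Sum>t<T. q w t) \<le> \<gamma>\<^sup>2" if "w \<in> l2_unit_ball" for w T
      using cSUP_upper[OF that bdd] sum_le_suminf[OF summable[OF that], of "{..<T}"] q_nonneg
      by fastforce
    then interpret l2_gain F Bw S \<gamma>
      using finite_horizon_gain_of_unit_ball[OF S, of F Bw "\<gamma>\<^sup>2"] S W
      by unfold_locales (auto simp: q_def)
    show "\<exists>P. pos_def P \<and> (K, \<gamma>, P) \<in> L_lft A B Bw Q R"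
      using ex_storage_matrix L by metis
  qed
qed

theorem proposition2:
  fixes A :: "real^'x^'x" and B :: "real^'u^'x" and Bw :: "real^'w^'x"
    and Q :: "real^'x^'x" and R :: "real^'u^'u"
  assumes "controllable A B"
    and "pos_def Q" and "pos_def R" and "pos_def (Bw ** transpose Bw)"
  shows "(\<forall>K \<gamma>. \<gamma> > 0 \<longrightarrow>
            ((K, \<gamma>) \<in> epi_J_inf A B Bw Q R \<longleftrightarrow>
             (\<exists>P. pos_def P \<and> (K, \<gamma>, P) \<in> L_lft A B Bw Q R))) \<and>
         bij_betw \<Phi> (L_lft A B Bw Q R) (F_cvx A B Bw Q R) \<and>
         inf_differentiable_on ambient_lft ambient_cvx (L_lft A B Bw Q R) \<Phi> \<and>
         inf_differentiable_on ambient_cvx ambient_lft (F_cvx A B Bw Q R)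
           (inv_into (L_lft A B Bw Q R) \<Phi>)"
proof (intro conjI allI impI)
  let ?L = "L_lft A B Bw Q R" and ?F = "F_cvx A B Bw Q R"
  show bij: "bij_betw \<Phi> ?L ?F" using assms(2,3) by (rule bij_betw_Phi)
  show "inf_differentiable_on ambient_lft ambient_cvx ?L \<Phi>"
    by (rule inf_differentiable_on_Phi)
      (auto simp: L_lft_def ambient_lft_def pos_def_invertible, simp add: pos_def_def)
  have "inv_into ?L \<Phi> z = \<Psi> z" if "z \<in> ?F" for z
  proof (rule inv_into_f_eq)
    show "inj_on \<Phi> ?L" using bij by (rule bij_betw_imp_inj_on)
    show "\<Psi> z \<in> ?L" using Psi_mem_L_lft assms that by blast
    show "\<Phi> (\<Psi> z) = z" using that by (auto simp: F_cvx_def Phi_Psi)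
  qed
  then show "inf_differentiable_on ambient_cvx ambient_lft ?F (inv_into ?L \<Phi>)"
    by (intro inf_differentiable_on_Psi)
      (auto simp: F_cvx_def ambient_cvx_def pos_def_invertible, simp add: pos_def_def)
qed (rule epi_J_inf_iff[OF assms(2-4)])

end
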